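(* Let $P\subset\mathbb{H}^4$ be a finite-volume convex hyperbolic $4$-polytope all of whose dihedral angles are equal to a common angle $\alpha\in(0,\pi/2)$. Then $P$ is simple and $\alpha\geq\alpha_0=\arccos\frac13$. If $\alpha=\alpha_0$, every vertex of $P$ is ideal. If $\alpha>\alpha_0$, every vertex of $P$ is finite and $P$ is compact.
   Context: $\mathbb{H}^4$ is hyperbolic $4$-space of curvature $-1$. A convex hyperbolic $4$-polytope is an intersection of finitely many closed half-spaces with nonempty interior. Vertices of a finite-volume polytope may be finite (ordinary points of $\mathbb{H}^4$) or ideal (points of the sphere at infinity); both count as vertices. "All dihedral angles equal $\alpha$" means that any two facets meeting along a $2$-dimensional face do so at interior dihedral angle $\alpha$. The polytope $P$ is simple if every vertex (finite or ideal) belongs to exactly four facets. *)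

theory Defs
  imports "HOL-Analysis.Analysis"
begin

(* Hyperbolic 4-space of curvature -1 in the Klein (projective) model: the points are those of
   the open unit ball, the sphere at infinity is the unit sphere, and geodesics are straight
   segments.  Hence hyperbolic convexity, faces and their dimensions are the Euclidean ones. *)

abbreviation hyp_space :: "(real^4) set"
  where "hyp_space \<equiv> ball 0 1"

abbreviation sphere_at_infinity :: "(real^4) set"
  where "sphere_at_infinity \<equiv> sphere 0 1"

(* The Riemannian metric of the model at x.  It is the pull-back of the Lorentz form
   - s t + v \<bullet> w under x \<mapsto> (1, x) / sqrt (1 - |x|^2), the inverse of the central
   projection of the hyperboloid. *)

definition klein_inner :: "real^4 \<Rightarrow> real^4 \<Rightarrow> real^4 \<Rightarrow> real" where
  "klein_inner x u w =
     (u \<bullet> w) / (1 - (norm x)\<^sup>2) + (x \<bullet> u) * (x \<bullet> w) / (1 - (norm x)\<^sup>2)\<^sup>2"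

(* The density is the square root of the determinant of klein_inner x, which is
   (1 - |x|^2)^(-5). *)

definition hyp_volume :: "(real^4) measure" where
  "hyp_volume = density lborel
     (\<lambda>x. if x \<in> hyp_space then ennreal ((1 - (norm x)\<^sup>2) powr (- 5 / 2)) else 0)"

(* The condition on b says exactly that the bounding hyperplane meets the open ball. *)

definition hyp_halfspace :: "(real^4) set \<Rightarrow> bool" where
  "hyp_halfspace H \<longleftrightarrow> (\<exists>a b. \<bar>b\<bar> < norm a \<and> H = {x \<in> hyp_space. a \<bullet> x \<le> b})"

definition hyp_polytope :: "(real^4) set \<Rightarrow> bool" where
  "hyp_polytope P \<longleftrightarrow>
     (\<exists>\<H>. finite \<H> \<and> (\<forall>H\<in>\<H>. hyp_halfspace H) \<and> P = hyp_space \<inter> \<Inter>\<H>) \<and>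
     interior P \<noteq> {}"

definition finite_volume :: "(real^4) set \<Rightarrow> bool" where
  "finite_volume P \<longleftrightarrow> emeasure hyp_volume P < \<infinity>"

(* The vertices of P in the closed ball: those in hyp_space are the finite vertices, those in
   sphere_at_infinity the ideal ones.  Every point of the closure of P on the unit sphere is an
   extreme point of the closure, so this notion is meant for P of finite volume only, where every
   such point is an ideal vertex. *)

definition vertices :: "(real^4) set \<Rightarrow> (real^4) set" where
  "vertices P = {v. v extreme_point_of closure P}"

(* The closure of F is needed for ideal vertices: v belongs to a facet when it is a point at
   infinity of it. *)

definition simple_hyp_polytope :: "(real^4) set \<Rightarrow> bool" where
  "simple_hyp_polytope P \<longleftrightarrow>
     (\<forall>v\<in>vertices P. card {F. F facet_of P \<and> v \<in> closure F} = 4)"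

(* The outward unit normal of P along its facet F at a point x of F, all with respect to the
   hyperbolic metric at x; y - x is the direction at x of the geodesic from x to y. *)

definition outward_normal :: "(real^4) set \<Rightarrow> (real^4) set \<Rightarrow> real^4 \<Rightarrow> real^4" where
  "outward_normal P F x = (THE n. klein_inner x n n = 1 \<and>
     (\<forall>y\<in>F. klein_inner x n (y - x) = 0) \<and>
     (\<forall>y\<in>P. klein_inner x n (y - x) \<le> 0))"

(* The interior angle at a point x of the intersection of F and G; it does not depend on x. *)

definition dihedral_angle_at ::
    "(real^4) set \<Rightarrow> (real^4) set \<Rightarrow> (real^4) set \<Rightarrow> real^4 \<Rightarrow> real" where
  "dihedral_angle_at P F G x =
     pi - arccos (klein_inner x (outward_normal P F x) (outward_normal P G x))"

definition all_dihedral_angles :: "(real^4) set \<Rightarrow> real \<Rightarrow> bool" where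
  "all_dihedral_angles P \<alpha> \<longleftrightarrow>
     (\<forall>F G. F facet_of P \<and> G facet_of P \<and> aff_dim (F \<inter> G) = 2 \<longrightarrow>
        (\<forall>x \<in> F \<inter> G. dihedral_angle_at P F G x = \<alpha>))"

end

theory Submission imports Defs begin

text \<open>
A point \<open>x\<close> of the closed unit ball stands for the line through \<open>(1, x)\<close> in Minkowski space, and each
facet of the closure \<open>Q\<close> of the polytope has an outward unit normal \<open>(b, a)\<close> there.  The proof is linear
algebra with the Lorentz products \<open>a \<bullet> a' - b * b'\<close> of these normals.  Finite volume enters only to show
that \<open>Q\<close> does not stick out of the closed ball (\<open>finite_volume_imp_bounded_by_sphere\<close>), so that \<open>Q\<close> is a
compact polytope whose extreme points are finite or ideal.  The angle hypothesis says that the product is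
\<open>- cos \<alpha> < 0\<close> for two facets that meet in a ridge (\<open>dihedral_angle_imp_inner\<close>).

The first point is that the product is then negative for any two facets, adjacent or not
(\<open>facet_covectors_obtuse\<close>).  The perpendicular dropped from a point of a facet \<open>G\<close> to the hyperplane of
another facet \<open>F\<close> moves it further inside all neighbours of \<open>F\<close>, so that its foot is inside \<open>F\<close>; with a
nonnegative product of the normals of \<open>F\<close> and \<open>G\<close> it would not move inside \<open>G\<close>.

The second point is that the normals of the facets through a vertex \<open>v\<close> live in the Lorentz complement
of \<open>(1, v)\<close>, where the Lorentz form is positive definite for a finite vertex and positive semidefinite
with radical spanned by \<open>(1, v)\<close> for an ideal one.  In both cases vectors with negative mutual products
on one side of a hyperplane are linearly independent (\<open>obtuse_vectors_independent\<close>).  Since \<open>v\<close> is a vertex,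
they also span the complement, so there are exactly four of them and \<open>P\<close> is simple.

Independence makes any two of these four facets meet in a ridge.  So the Gram matrix has the entries
\<open>1\<close> on and \<open>- cos \<alpha>\<close> off the diagonal, and its determinant has the sign of \<open>1 - 3 * cos \<alpha>\<close>
(\<open>equiangular_basis_gram\<close>).  It is positive at a finite vertex and zero at an ideal one.  As \<open>\<alpha>\<close> is the same
at all vertices, all are finite with \<open>\<alpha> > arccos (1 / 3)\<close> or all are ideal with \<open>\<alpha> = arccos (1 / 3)\<close>.  In the
first case \<open>Q\<close>, the convex hull of its vertices, lies in the open ball, hence \<open>P = Q\<close> is compact.
\<close>

section \<open>Covectors of the facets of a polytope in the closed unit ball\<close>

text \<open>The pair \<open>(a, b)\<close> is the outward unit normal of the facet in Minkowski space: a point \<open>x\<close> of the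
ball stands for the line through \<open>(1, x)\<close>, and \<open>a \<bullet> x - b\<close> is the Lorentz product of \<open>(b, a)\<close> with
\<open>(1, x)\<close>.  The normalisation says that \<open>(b, a)\<close> has Lorentz square one; accordingly the Lorentz
product of two such pairs is \<open>a \<bullet> a' - b * b'\<close>.\<close>

definition facet_covector :: "'a::euclidean_space set \<Rightarrow> 'a set \<Rightarrow> 'a \<Rightarrow> real \<Rightarrow> bool" where
  "facet_covector Q F a b \<longleftrightarrow>
     Q \<subseteq> {x. a \<bullet> x \<le> b} \<and> F = Q \<inter> {x. a \<bullet> x = b} \<and> a \<bullet> a - b * b = 1"

text \<open>Strict convexity of the unit ball: the parallelogram law makes the squared norm of the midpoint
fall short of the mean of the two squared norms.\<close>

lemma norm_midpoint_less_1:
  fixes x y :: "'a::real_inner"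
  assumes "norm x \<le> 1" "norm y \<le> 1" "x \<noteq> y"
  shows "norm (midpoint x y) < 1"
proof -
  have sq: "x \<bullet> x \<le> 1" "y \<bullet> y \<le> 1"
    using assms by (simp_all add: dot_square_norm power_le_one)
  have pos: "(x - y) \<bullet> (x - y) > 0"
    using assms by simp
  have "4 * (midpoint x y \<bullet> midpoint x y) = 2 * (x \<bullet> x) + 2 * (y \<bullet> y) - (x - y) \<bullet> (x - y)"
    by (simp add: midpoint_def inner_simps inner_commute algebra_simps)
  then have "midpoint x y \<bullet> midpoint x y < 1"
    using sq pos by linarith
  then show ?thesis
    by (metis norm_eq_sqrt_inner real_sqrt_lt_1_iff)
qed

text \<open>The source of actual points of hyperbolic space in the faces used below: a face of dimension at
least one cannot lie inside the sphere at infinity.\<close>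

lemma convex_meets_ball:
  fixes F :: "'a::euclidean_space set"
  assumes "convex F" "F \<subseteq> cball 0 1" "aff_dim F \<ge> 1"
  obtains m where "m \<in> F" "norm m < 1"
proof -
  have "\<not> (\<exists>x. F \<subseteq> {x})"
    using assms(3) aff_dim_subset[of F] aff_dim_sing by (metis not_one_le_zero order_trans)
  then obtain x y where xy: "x \<in> F" "y \<in> F" "x \<noteq> y"
    by blast
  have "midpoint x y \<in> F"
    using xy assms(1) closed_segment_subset[of x F y] by auto
  moreover have "norm (midpoint x y) < 1"
    using xy assms(2) by (intro norm_midpoint_less_1) auto
  ultimately show ?thesis ..
qed

text \<open>A supporting hyperplane along a facet can be normalised because it passes through the open ball,
where the Cauchy-Schwarz inequality forces \<open>\<bar>b\<bar> < norm a\<close>.\<close>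

lemma facet_covector_exists:
  fixes Q :: "'a::euclidean_space set"
  assumes "polyhedron Q" "Q \<subseteq> cball 0 1" "interior Q \<noteq> {}" "DIM('a) \<ge> 2" "F facet_of Q"
  shows "\<exists>a b. facet_covector Q F a b"
proof -
  obtain a b where ab: "a \<noteq> 0" "Q \<subseteq> {x. a \<bullet> x \<le> b}" "F = Q \<inter> {x. a \<bullet> x = b}"
    using facet_of_polyhedron[OF assms(1,5)] by blast
  have "aff_dim F \<ge> 1"
    using assms by (simp add: facet_of_def aff_dim_nonempty_interior)
  moreover have "convex F" "F \<subseteq> cball 0 1"
    using assms face_of_imp_convex facet_of_imp_face_of facet_of_imp_subset by blast+
  ultimately obtain m where m: "m \<in> F" "norm m < 1"
    using convex_meets_ball by blast
  have "\<bar>b\<bar> \<le> norm a * norm m"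
    using m ab Cauchy_Schwarz_ineq2[of a m] by auto
  also have "\<dots> < norm a"
    using m ab by simp
  finally have "b\<^sup>2 < (norm a)\<^sup>2"
    by (metis abs_le_square_iff abs_norm_cancel linorder_not_le)
  then have pos: "a \<bullet> a - b * b > 0"
    by (simp add: dot_square_norm power2_eq_square)
  define k where "k = sqrt (a \<bullet> a - b * b)"
  have k: "k > 0" "k * k = a \<bullet> a - b * b"
    using pos by (auto simp: k_def)
  have "facet_covector Q F (a /\<^sub>R k) (b / k)"
    unfolding facet_covector_def
  proof (intro conjI)
    show "Q \<subseteq> {x. (a /\<^sub>R k) \<bullet> x \<le> b / k}"
      using ab(2) k(1) by (auto simp: field_simps)
    show "F = Q \<inter> {x. (a /\<^sub>R k) \<bullet> x = b / k}"
      using ab(3) k(1) by (auto simp: field_simps)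
    show "(a /\<^sub>R k) \<bullet> (a /\<^sub>R k) - b / k * (b / k) = 1"
      using k pos by (simp add: divide_simps)
  qed
  then show ?thesis by blast
qed

lemma segment_leaves_through_facet:
  fixes S :: "'a::euclidean_space set"
  assumes "polyhedron S" "bounded S" "q \<in> rel_interior S" "y \<in> affine hull S" "y \<notin> rel_interior S"
  obtains G t where "G facet_of S" "0 < t" "t \<le> 1" "q + t *\<^sub>R (y - q) \<in> G"
proof -
  have "q \<noteq> y"
    using assms by blast
  obtain d where d: "0 < d" "q + d *\<^sub>R (y - q) \<in> rel_frontier S"
      "\<And>e. \<lbrakk>0 \<le> e; e < d\<rbrakk> \<Longrightarrow> q + e *\<^sub>R (y - q) \<in> rel_interior S"
  proof (rule ray_to_rel_frontier[OF assms(2,3), of "y - q"])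
    show "q + (y - q) \<in> affine hull S" using assms by simp
  qed (use \<open>q \<noteq> y\<close> in auto)
  have "d \<le> 1"
    using d(3)[of 1] assms(5) by force
  moreover have "q + d *\<^sub>R (y - q) \<in> \<Union>{F. F facet_of S}"
    using d(2) assms(1) rel_frontier_of_polyhedron by blast
  ultimately show ?thesis
    using that d(1) by blast
qed

lemma facet_covector_strict_interior:
  fixes Q :: "'a::euclidean_space set"
  assumes "convex Q" "interior Q \<noteq> {}" "F facet_of Q" "facet_covector Q F a b" "x \<in> interior Q"
  shows "a \<bullet> x < b"
proof -
  have "F \<noteq> Q"
    using assms(3) facet_of_irrefl by blast
  then have "x \<notin> F"
    using face_of_disjoint_interior[OF facet_of_imp_face_of[OF assms(3)]] assms(5) by blast
  moreover have "x \<in> Q"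
    using assms(5) interior_subset by blast
  ultimately show ?thesis
    using assms(4) by (fastforce simp: facet_covector_def)
qed

lemma facets_antichain:
  fixes Q :: "'a::euclidean_space set"
  assumes "convex Q" "F facet_of Q" "G facet_of Q" "F \<subseteq> G"
  shows "F = G"
proof (rule ccontr)
  assume "F \<noteq> G"
  have "F face_of G"
    using assms by (meson face_of_subset facet_of_def facet_of_imp_subset)
  moreover have "convex G"
    using assms(3) face_of_imp_convex facet_of_imp_face_of by blast
  ultimately have "aff_dim F < aff_dim G"
    using \<open>F \<noteq> G\<close> face_of_aff_dim_lt by blast
  then show False
    using assms(2,3) by (simp add: facet_of_def)
qed

text \<open>A proper face of a polyhedron is the intersection of the facets that contain it, so a face of
codimension two lies in a second facet, and for dimension reasons it is the intersection of the two.\<close>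

lemma ridge_in_second_facet:
  fixes Q :: "'a::euclidean_space set"
  assumes "polyhedron Q" "F facet_of Q" "G facet_of F"
  obtains K where "K facet_of Q" "K \<noteq> F" "G = F \<inter> K" "aff_dim (F \<inter> K) = aff_dim Q - 2"
proof -
  have conv: "convex Q"
    using assms(1) polyhedron_imp_convex by blast
  have Gdim: "aff_dim G = aff_dim Q - 2" "G \<noteq> {}"
    using assms by (auto simp: facet_of_def)
  have GF: "G face_of F"
    using assms(3) by (simp add: facet_of_def)
  have GQ: "G face_of Q"
    using GF assms(2) face_of_face facet_of_def by blast
  have "G \<noteq> Q" "G \<noteq> F"
    using Gdim assms(2) by (auto simp: facet_of_def)
  have inter: "G = \<Inter>{F. F facet_of Q \<and> G \<subseteq> F}"
    by (rule face_of_polyhedron[OF assms(1) GQ Gdim(2) \<open>G \<noteq> Q\<close>])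
  obtain K where K: "K facet_of Q" "K \<noteq> F" "G \<subseteq> K"
  proof (rule ccontr)
    assume "\<not> thesis"
    then have "{F. F facet_of Q \<and> G \<subseteq> F} = {F}"
      using that assms(2) face_of_imp_subset[OF GF] by blast
    then show False
      using inter \<open>G \<noteq> F\<close> by simp
  qed
  have "F \<inter> K \<noteq> F"
    using facets_antichain[OF conv assms(2) K(1)] K(2) by blast
  have convF: "convex F"
    using assms(2) face_of_imp_convex facet_of_imp_face_of by blast
  have fkF: "F \<inter> K face_of F"
    using assms(2) K(1)
    by (meson face_of_Int face_of_subset facet_of_def facet_of_imp_subset inf_le1)
  then have less: "aff_dim (F \<inter> K) < aff_dim F"
    using face_of_aff_dim_lt[OF convF] \<open>F \<inter> K \<noteq> F\<close> by blast
  have sub: "G \<subseteq> F \<inter> K"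
    using K(3) face_of_imp_subset[OF GF] by blast
  have "G face_of F \<inter> K"
    using face_of_subset[OF GF sub] by blast
  moreover have "aff_dim (F \<inter> K) \<le> aff_dim G"
    using less Gdim assms(2) by (simp add: facet_of_def)
  moreover have "convex (F \<inter> K)"
    using fkF face_of_imp_convex by blast
  ultimately have "G = F \<inter> K"
    using face_of_aff_dim_lt[of "F \<inter> K" G] by fastforce
  then show ?thesis
    using that K Gdim by blast
qed

section \<open>Acute angles at the ridges make all pairs of facet normals obtuse\<close>

lemma affine_hull_hyperplane_eq:
  fixes F :: "'a::euclidean_space set"
  assumes "F \<subseteq> {x. a \<bullet> x = b}" "a \<noteq> 0" "aff_dim F = int DIM('a) - 1" "F \<noteq> {}"
  shows "affine hull F = {x. a \<bullet> x = b}"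
proof (rule affine_dim_equal)
  show "affine hull F \<subseteq> {x. a \<bullet> x = b}"
    using assms(1) by (intro hull_minimal) (auto simp: affine_hyperplane)
qed (use assms in \<open>auto simp: affine_hyperplane\<close>)

text \<open>Acuteness at the ridges of a single facet \<open>F\<close> already controls every other facet \<open>G\<close>.  Take a
point \<open>p\<close> in the relative interior of \<open>G\<close> and drop the hyperbolic perpendicular from \<open>p\<close> to the
hyperplane of \<open>F\<close>; let \<open>y\<close> be its foot.  In Minkowski space this adds a positive multiple of the
normal of \<open>F\<close> to \<open>p\<close>, so the obtuse products with the normals of the neighbours of \<open>F\<close> keep \<open>y\<close>
strictly on the inner side of those neighbours.  The neighbours cut \<open>F\<close> out of its hyperplane, so
\<open>y\<close> lies in the relative interior of \<open>F\<close>.  But if the product of the normals of \<open>F\<close> and \<open>G\<close> were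
nonnegative, the same displacement would push \<open>y\<close> to the outer side of \<open>G\<close> or leave it on the
hyperplane of \<open>G\<close>.\<close>

lemma facet_covectors_obtuse:
  fixes Q :: "'a::euclidean_space set"
  assumes Q: "polyhedron Q" "Q \<subseteq> cball 0 1" "interior Q \<noteq> {}" "DIM('a) \<ge> 2"
    and F: "F facet_of Q" "facet_covector Q F a b"
    and G: "G facet_of Q" "facet_covector Q G c d" "F \<noteq> G"
    and adj: "\<And>K a' b'. \<lbrakk>K facet_of Q; aff_dim (F \<inter> K) = aff_dim Q - 2; facet_covector Q K a' b'\<rbrakk>
           \<Longrightarrow> a \<bullet> a' - b * b' < 0"
  shows "a \<bullet> c - b * d < 0"
proof (rule ccontr)
  assume "\<not> a \<bullet> c - b * d < 0"
  then have nonneg: "a \<bullet> c - b * d \<ge> 0" by simp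
  have conv: "convex Q" using Q(1) polyhedron_imp_convex by blast
  have bddF: "bounded F"
    using Q(2) F(1) by (meson bounded_cball bounded_subset facet_of_imp_subset)
  have polyF: "polyhedron F"
    using Q(1) F(1) face_of_polyhedron_polyhedron facet_of_imp_face_of by blast
  have convF: "convex F" and convG: "convex G"
    using F(1) G(1) face_of_imp_convex facet_of_imp_face_of by blast+
  have ne: "F \<noteq> {}" "G \<noteq> {}" using F(1) G(1) by (auto simp: facet_of_def)
  obtain p where p: "p \<in> rel_interior G"
    using convG ne rel_interior_eq_empty by blast
  then have pG: "p \<in> G" using rel_interior_subset by blast
  have pQ: "p \<in> Q" using pG G(1) facet_of_imp_subset by blast
  have off: "a' \<bullet> p < b'" if "K facet_of Q" "K \<noteq> G" "facet_covector Q K a' b'" for K a' b'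
  proof -
    have "p \<notin> K"
    proof
      assume "p \<in> K"
      then have "G \<subseteq> K"
        using subset_of_face_of[of K Q G] that(1) G(1) p facet_of_imp_face_of facet_of_imp_subset
        by blast
      then show False
        using facets_antichain[OF conv G(1) that(1)] that(2) by blast
    qed
    then show ?thesis
      using that(3) pQ by (fastforce simp: facet_covector_def)
  qed
  have aabb: "a \<bullet> a - b * b = 1" using F(2) by (simp add: facet_covector_def)
  \<comment> \<open>The Lorentz projection of (1, p) along (b, a) is (1, p) + t (b, a); rescaling its first
    coordinate to 1 gives the point y below.\<close>
  define t where "t = b - a \<bullet> p"
  have t: "t > 0" using off[OF F(1) _ F(2)] G(3) by (simp add: t_def)
  have den: "1 + t * b > 0"
  proof -
    have "\<bar>a \<bullet> p\<bar> \<le> norm a"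
      using Cauchy_Schwarz_ineq2[of a p] pQ Q(2) mult_left_le[of "norm p" "norm a"] by force
    moreover have "\<bar>b\<bar> < norm a"
      using aabb by (metis abs_le_square_iff abs_norm_cancel diff_gt_0_iff_gt dot_square_norm
          linorder_not_le power2_eq_square zero_less_one)
    ultimately have "\<bar>b\<bar> * \<bar>a \<bullet> p\<bar> < norm a * norm a"
      by (meson abs_ge_zero mult_left_mono mult_strict_right_mono order.strict_trans1
          order_le_less_trans)
    moreover have "b * (a \<bullet> p) \<le> \<bar>b\<bar> * \<bar>a \<bullet> p\<bar>"
      by (metis abs_ge_self abs_mult)
    moreover have "a \<bullet> a = norm a * norm a"
      by (simp add: dot_square_norm power2_eq_square)
    ultimately have "b * (a \<bullet> p) < a \<bullet> a"
      by linarith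
    then show ?thesis
      using aabb by (simp add: t_def algebra_simps)
  qed
  define y where "y = (p + t *\<^sub>R a) /\<^sub>R (1 + t * b)"
  \<comment> \<open>The affine function of any covector at y, up to the positive factor 1 + t b.\<close>
  have ell: "(a' \<bullet> y - b') * (1 + t * b) = (a' \<bullet> p - b') + t * (a \<bullet> a' - b * b')" for a' b'
  proof -
    have "(a' \<bullet> y) * (1 + t * b) = a' \<bullet> (p + t *\<^sub>R a)"
      using den by (simp add: y_def)
    then show ?thesis
      by (simp add: inner_simps inner_commute[of a' a] algebra_simps)
  qed
  have ay: "a \<bullet> y = b"
  proof -
    have "(a \<bullet> y - b) * (1 + t * b) = 0"
      unfolding ell using aabb by (simp add: t_def)
    then show ?thesis using den by simp
  qed
  have cy: "c \<bullet> y \<ge> d"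
  proof -
    have "(c \<bullet> y - d) * (1 + t * b) \<ge> 0"
      unfolding ell using pG G(2) nonneg t by (simp add: facet_covector_def)
    then show ?thesis using den by (simp add: zero_le_mult_iff)
  qed
  have adjy: "a' \<bullet> y < b'"
    if "K facet_of Q" "K \<noteq> G" "aff_dim (F \<inter> K) = aff_dim Q - 2" "facet_covector Q K a' b'"
    for K a' b'
  proof -
    have "(a' \<bullet> y - b') * (1 + t * b) < 0"
      unfolding ell using off[OF that(1,2,4)] adj[OF that(1,3,4)] t
      by (smt (verit) mult_pos_neg)
    then show ?thesis using den by (simp add: mult_less_0_iff)
  qed
  have yaff: "y \<in> affine hull F"
  proof -
    have "a \<noteq> 0"
    proof
      assume "a = 0"
      then have "- (b * b) = 1" using aabb by simp
      then show False using zero_le_square[of b] by linarith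
    qed
    then have "affine hull F = {x. a \<bullet> x = b}"
      using F Q(3) ne by (intro affine_hull_hyperplane_eq)
        (auto simp: facet_of_def facet_covector_def aff_dim_nonempty_interior)
    then show ?thesis using ay by simp
  qed
  \<comment> \<open>Another facet through a relative interior point of F would contain F.\<close>
  have relF: "\<not> (x \<in> K \<and> x \<in> rel_interior F)" if "K facet_of Q" "K \<noteq> F" for K x
    using subset_of_face_of[of K Q F] that F(1) facet_of_imp_face_of facet_of_imp_subset
      facets_antichain[OF conv F(1) that(1)] by blast
  have nadj: "aff_dim (F \<inter> G) \<noteq> aff_dim Q - 2"
    using adj[OF G(1) _ G(2)] nonneg by linarith
  obtain q where q: "q \<in> rel_interior F"
    using convF ne rel_interior_eq_empty by blast
  have qQ: "q \<in> Q" using q F(1) rel_interior_subset facet_of_imp_subset by blast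
  have "y \<notin> rel_interior F"
  proof
    assume yF: "y \<in> rel_interior F"
    then have "y \<in> Q" using F(1) rel_interior_subset facet_of_imp_subset by blast
    then have "y \<in> G" using G(2) cy by (fastforce simp: facet_covector_def)
    then show False using relF[OF G(1)] G(3) yF by blast
  qed
  then obtain R s where R: "R facet_of F" "0 < s" "s \<le> 1" "q + s *\<^sub>R (y - q) \<in> R"
    using segment_leaves_through_facet[OF polyF bddF q yaff] by blast
  obtain K where K: "K facet_of Q" "K \<noteq> F" "R = F \<inter> K" "aff_dim (F \<inter> K) = aff_dim Q - 2"
    using ridge_in_second_facet[OF Q(1) F(1) R(1)] by blast
  obtain a' b' where K': "facet_covector Q K a' b'"
    using facet_covector_exists[OF Q K(1)] by blast
  have "a' \<bullet> y < b'" using adjy[OF K(1) _ K(4) K'] nadj K(4) by blast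
  moreover have "a' \<bullet> q < b'"
    using relF[OF K(1,2)] q qQ K' by (fastforce simp: facet_covector_def)
  ultimately have "(1 - s) * (a' \<bullet> q) + s * (a' \<bullet> y) < b'"
    using R(2,3) convex_bound_lt[of "a' \<bullet> q" b' "a' \<bullet> y" "1 - s" s] by simp
  moreover have "a' \<bullet> (q + s *\<^sub>R (y - q)) = b'"
    using R(4) K(3) K' by (auto simp: facet_covector_def)
  ultimately show False by (simp add: inner_simps algebra_simps)
qed

section \<open>Facets through a vertex\<close>

lemma sum_negative:
  fixes f :: "'b \<Rightarrow> real"
  assumes "finite A" "A \<noteq> {}" "\<And>x. x \<in> A \<Longrightarrow> f x < 0"
  shows "sum f A < 0"
  using sum_strict_mono[OF assms(1,2), of f "\<lambda>_. 0"] assms(3) by simp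

text \<open>A nontrivial linear relation splits into two nonnegative combinations with the same value \<open>x\<close>.
The half-space makes \<open>x\<close> nonzero, so both sides occur, and then the form evaluates on \<open>(x, x)\<close> to
a sum of negative terms, although it is positive semidefinite for \<open>norm v \<le> 1\<close>.  Strict negativity
is what lets the degenerate case \<open>norm v = 1\<close> of an ideal vertex go through unchanged.\<close>

lemma obtuse_vectors_independent:
  fixes S :: "'a::euclidean_space set"
  assumes fin: "finite S" and v: "norm v \<le> 1"
    and side: "\<And>a. a \<in> S \<Longrightarrow> a \<bullet> p < 0"
    and obt: "\<And>a b. \<lbrakk>a \<in> S; b \<in> S; a \<noteq> b\<rbrakk> \<Longrightarrow> a \<bullet> b - (a \<bullet> v) * (b \<bullet> v) < 0"
  shows "independent S"
proof
  assume "dependent S"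
  then obtain u0 where u0: "\<exists>a\<in>S. u0 a \<noteq> 0" "(\<Sum>a\<in>S. u0 a *\<^sub>R a) = 0"
    using fin dependent_finite by blast
  obtain u where u: "\<exists>a\<in>S. u a > 0" "(\<Sum>a\<in>S. u a *\<^sub>R a) = 0"
  proof (cases "\<exists>a\<in>S. u0 a > 0")
    case True
    then show ?thesis using that u0 by blast
  next
    case False
    then show ?thesis
      using that[of "\<lambda>a. - u0 a"] u0 by (force simp: sum_negf)
  qed
  define A where "A = {a \<in> S. u a > 0}"
  define x where "x = (\<Sum>a\<in>A. u a *\<^sub>R a)"
  have A: "A \<subseteq> S" "finite A" "A \<noteq> {}" and uA: "\<And>a. a \<in> A \<Longrightarrow> u a > 0"
    using fin u(1) by (auto simp: A_def)
  have uB: "\<And>b. b \<in> S - A \<Longrightarrow> - u b \<ge> 0"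
    by (auto simp: A_def)
  have "(\<Sum>a\<in>S. u a *\<^sub>R a) = (\<Sum>b\<in>S - A. u b *\<^sub>R b) + x"
    unfolding x_def using A(1) fin by (rule sum.subset_diff)
  then have xB: "x = (\<Sum>b\<in>S - A. (- u b) *\<^sub>R b)"
    using u(2) by (simp add: sum_negf eq_neg_iff_add_eq_0 add.commute)
  have "x \<bullet> p = (\<Sum>a\<in>A. u a * (a \<bullet> p))"
    by (simp add: x_def inner_sum_left)
  also have "\<dots> < 0"
    using A side uA by (intro sum_negative) (auto simp: mult_pos_neg subset_iff)
  finally have "x \<noteq> 0"
    by auto
  then obtain b0 where b0: "b0 \<in> S - A" "u b0 \<noteq> 0"
    unfolding xB by (metis (no_types, lifting) add.inverse_neutral scale_eq_0_iff sum.neutral)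
  have qxb: "x \<bullet> b - (x \<bullet> v) * (b \<bullet> v) < 0" if b: "b \<in> S - A" for b
  proof -
    have "x \<bullet> b - (x \<bullet> v) * (b \<bullet> v) = (\<Sum>a\<in>A. u a * (a \<bullet> b - (a \<bullet> v) * (b \<bullet> v)))"
      by (simp add: x_def inner_sum_left sum_distrib_left sum_subtractf algebra_simps)
    also have "\<dots> < 0"
      using A uA b obt by (intro sum_negative mult_pos_neg) auto
    finally show ?thesis .
  qed
  have "x \<bullet> x - (x \<bullet> v) * (x \<bullet> v) = (\<Sum>b\<in>S - A. (- u b) * (x \<bullet> b - (x \<bullet> v) * (b \<bullet> v)))"
  proof -
    have expand: "x \<bullet> y = (\<Sum>b\<in>S - A. (- u b) * (b \<bullet> y))" for y
      by (subst xB) (simp only: inner_sum_left inner_scaleR_left)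
    have "(x \<bullet> v) * (x \<bullet> v) = (\<Sum>b\<in>S - A. (- u b) * ((x \<bullet> v) * (b \<bullet> v)))"
      by (subst (2) expand) (simp add: sum_distrib_left mult.left_commute)
    then have "x \<bullet> x - (x \<bullet> v) * (x \<bullet> v)
        = (\<Sum>b\<in>S - A. (- u b) * (b \<bullet> x)) - (\<Sum>b\<in>S - A. (- u b) * ((x \<bullet> v) * (b \<bullet> v)))"
      using expand[of x] by linarith
    also have "\<dots> = (\<Sum>b\<in>S - A. (- u b) * (b \<bullet> x) - (- u b) * ((x \<bullet> v) * (b \<bullet> v)))"
      by (simp only: sum_subtractf)
    also have "\<dots> = (\<Sum>b\<in>S - A. (- u b) * (x \<bullet> b - (x \<bullet> v) * (b \<bullet> v)))"
      by (intro sum.cong refl) (simp add: inner_commute algebra_simps)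
    finally show ?thesis .
  qed
  also have "\<dots> < 0"
  proof -
    have "0 < (\<Sum>b\<in>S - A. (- u b) * - (x \<bullet> b - (x \<bullet> v) * (b \<bullet> v)))"
    proof (rule sum_pos2)
      show "finite (S - A)" using fin by simp
      show "b0 \<in> S - A" by fact
      show "0 < (- u b0) * - (x \<bullet> b0 - (x \<bullet> v) * (b0 \<bullet> v))"
        using uB[OF b0(1)] b0(2) qxb[OF b0(1)] by (intro mult_pos_pos) auto
      show "0 \<le> (- u b) * - (x \<bullet> b - (x \<bullet> v) * (b \<bullet> v))" if "b \<in> S - A" for b
        using uB[OF that] qxb[OF that] by (intro mult_nonneg_nonneg) auto
    qed
    then have "0 < - (\<Sum>b\<in>S - A. (- u b) * (x \<bullet> b - (x \<bullet> v) * (b \<bullet> v)))"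
      by (simp only: mult_minus_right sum_negf)
    then show ?thesis by simp
  qed
  finally have "x \<bullet> x < (x \<bullet> v) * (x \<bullet> v)"
    by simp
  moreover have "\<bar>x \<bullet> v\<bar> \<le> norm x"
    using Cauchy_Schwarz_ineq2[of x v] v mult_left_le[of "norm v" "norm x"] by force
  ultimately show False
    by (metis abs_le_square_iff abs_norm_cancel dot_square_norm linorder_not_le power2_eq_square)
qed

text \<open>A segment from an interior point to a point outside crosses a facet and violates its inequality
afterwards.\<close>

lemma mem_polyhedron_if_facet_inequalities:
  fixes Q :: "'a::euclidean_space set"
  assumes "polyhedron Q" "bounded Q" "interior Q \<noteq> {}"
    and cov: "\<And>F. F facet_of Q \<Longrightarrow> facet_covector Q F (nrm F) (off F)"
    and y: "\<And>F. F facet_of Q \<Longrightarrow> nrm F \<bullet> y \<le> off F"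
  shows "y \<in> Q"
proof (rule ccontr)
  assume "y \<notin> Q"
  then have y_notin: "y \<notin> rel_interior Q"
    using rel_interior_subset by blast
  obtain q where q: "q \<in> interior Q"
    using assms(3) by blast
  have "q \<in> rel_interior Q"
    using q by (simp add: rel_interior_nonempty_interior assms(3))
  moreover have "y \<in> affine hull Q"
    by (simp add: affine_hull_nonempty_interior assms(3))
  ultimately obtain G t where G: "G facet_of Q" "0 < t" "t \<le> 1" "q + t *\<^sub>R (y - q) \<in> G"
    using segment_leaves_through_facet[OF assms(1,2) _ _ y_notin] by blast
  have "nrm G \<bullet> q < off G"
    using facet_covector_strict_interior[OF polyhedron_imp_convex[OF assms(1)] assms(3) G(1) cov[OF G(1)] q] .
  have "nrm G \<bullet> (q + t *\<^sub>R (y - q)) = off G"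
    using G(4) cov[OF G(1)] by (auto simp: facet_covector_def)
  have "t = 1"
  proof (rule ccontr)
    assume "t \<noteq> 1"
    have "(1 - t) * (nrm G \<bullet> q) + t * (nrm G \<bullet> y) < (1 - t) * off G + t * off G"
      using G \<open>nrm G \<bullet> q < off G\<close> y[OF G(1)] \<open>t \<noteq> 1\<close>
      by (intro add_less_le_mono mult_strict_left_mono mult_left_mono) auto
    then show False
      using \<open>nrm G \<bullet> (q + t *\<^sub>R (y - q)) = off G\<close> by (simp add: inner_simps algebra_simps)
  qed
  then have "y \<in> G" using G(4) by simp
  then show False using \<open>y \<notin> Q\<close> facet_of_imp_subset[OF G(1)] by blast
qed

lemma inactive_facets_open:
  fixes Q :: "'a::euclidean_space set"
  assumes "polyhedron Q"
  shows "open {x. \<forall>F. F facet_of Q \<and> F \<notin> \<F> \<longrightarrow> nrm F \<bullet> x < (off F :: real)}" 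
proof -
  have "{x. \<forall>F. F facet_of Q \<and> F \<notin> \<F> \<longrightarrow> nrm F \<bullet> x < off F}
      = (\<Inter>F\<in>{F. F facet_of Q} - \<F>. {x. nrm F \<bullet> x < off F})"
    by auto
  then show ?thesis
    using finite_polyhedron_facets[OF assms] by (auto intro!: open_INT open_halfspace_lt)
qed

lemma small_step_keeps_inactive:
  fixes Q :: "'a::euclidean_space set"
  assumes "polyhedron Q" "v \<in> Q"
    and cov: "\<And>F. F facet_of Q \<Longrightarrow> facet_covector Q F (nrm F) (off F)"
  obtains e where "e > 0"
    "\<And>s F. \<lbrakk>\<bar>s\<bar> \<le> e; F facet_of Q; v \<notin> F\<rbrakk> \<Longrightarrow> nrm F \<bullet> (v + s *\<^sub>R w) < off F"
proof -
  let ?U = "{x. \<forall>F. F facet_of Q \<and> F \<notin> {F. v \<in> F} \<longrightarrow> nrm F \<bullet> x < off F}"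
  have "v \<in> ?U"
    using cov assms(2) by (fastforce simp: facet_covector_def)
  moreover have "open ?U"
    by (rule inactive_facets_open[OF assms(1)])
  ultimately obtain d where d: "d > 0" "ball v d \<subseteq> ?U"
    by (meson open_contains_ball)
  define e where "e = d / (2 * (norm w + 1))"
  have e: "e > 0" "e * (norm w + 1) < d"
    using d(1) norm_ge_zero[of w] by (auto simp: e_def add_nonneg_pos divide_simps simp del: norm_ge_zero)
  have "v + s *\<^sub>R w \<in> ball v d" if "\<bar>s\<bar> \<le> e" for s
  proof -
    have "\<bar>s\<bar> * norm w \<le> e * (norm w + 1)"
      using that e(1) by (intro mult_mono) auto
    then show ?thesis using e(2) by (simp add: dist_norm)
  qed
  then have "v + s *\<^sub>R w \<in> ?U" if "\<bar>s\<bar> \<le> e" for s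
    using that d(2) by blast
  then show ?thesis
    using that e(1) by blast
qed

text \<open>A vector orthogonal to all normals at the vertex could be followed a little in both directions
without leaving the polytope, and the vertex would be a midpoint.\<close>

lemma vertex_facet_normals_kernel:
  fixes Q :: "'a::euclidean_space set"
  assumes Q: "polyhedron Q" "bounded Q" "interior Q \<noteq> {}"
    and cov: "\<And>F. F facet_of Q \<Longrightarrow> facet_covector Q F (nrm F) (off F)"
    and v: "v extreme_point_of Q"
    and w: "\<And>F. \<lbrakk>F facet_of Q; v \<in> F\<rbrakk> \<Longrightarrow> nrm F \<bullet> w = 0"
  shows "w = 0"
proof (rule ccontr)
  assume "w \<noteq> 0"
  have vQ: "v \<in> Q" using v by (simp add: extreme_point_of_def)
  obtain e where e: "e > 0"
    "\<And>s F. \<lbrakk>\<bar>s\<bar> \<le> e; F facet_of Q; v \<notin> F\<rbrakk> \<Longrightarrow> nrm F \<bullet> (v + s *\<^sub>R w) < off F"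
    using small_step_keeps_inactive[OF Q(1) vQ cov] by blast
  have inQ: "v + s *\<^sub>R w \<in> Q" if "\<bar>s\<bar> \<le> e" for s
  proof (rule mem_polyhedron_if_facet_inequalities[OF Q cov])
    fix F assume F: "F facet_of Q"
    show "nrm F \<bullet> (v + s *\<^sub>R w) \<le> off F"
    proof (cases "v \<in> F")
      case True
      then show ?thesis using cov[OF F] w[OF F] by (auto simp: facet_covector_def inner_simps)
    qed (use e(2)[OF that F] in auto)
  qed
  have "v + (- e) *\<^sub>R w \<in> Q" "v + e *\<^sub>R w \<in> Q"
    using inQ[of "- e"] inQ[of e] e(1) by auto
  moreover have "v \<in> open_segment (v + (- e) *\<^sub>R w) (v + e *\<^sub>R w)"
  proof -
    have "v + (- e) *\<^sub>R w \<noteq> v + e *\<^sub>R w"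
    proof
      assume "v + (- e) *\<^sub>R w = v + e *\<^sub>R w"
      then have "(2 * e) *\<^sub>R w = 0" by (simp add: algebra_simps scaleR_2 flip: scaleR_scaleR)
      then show False using e(1) \<open>w \<noteq> 0\<close> by simp
    qed
    moreover have "v = midpoint (v + (- e) *\<^sub>R w) (v + e *\<^sub>R w)"
      by (simp add: midpoint_def algebra_simps flip: scaleR_add_left)
    ultimately show ?thesis by (metis midpoint_in_open_segment)
  qed
  ultimately show False
    using v by (simp add: extreme_point_of_def)
qed

lemma dual_vector:
  fixes S :: "'a::euclidean_space set"
  assumes "independent S"
  obtains w where "\<And>a. a \<in> S \<Longrightarrow> a \<bullet> w = f a"
proof -
  obtain g where g: "linear g" "\<forall>a\<in>S. g a = f a"
    using linear_independent_extend[OF assms, of f] by blast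
  have "a \<bullet> adjoint g (1::real) = f a" if "a \<in> S" for a
    using g that adjoint_works[OF g(1), of a 1] by simp
  then show ?thesis using that by blast
qed

text \<open>Independence allows a direction \<open>w\<close> at \<open>v\<close> that stays in the hyperplanes of \<open>F\<close> and \<open>G\<close> and
enters the open half-spaces of all other facets through \<open>v\<close>.  Hence \<open>F \<inter> G\<close> contains a relatively
open piece of the intersection of the two hyperplanes.\<close>

lemma independent_facets_meet_in_ridge:
  fixes Q :: "'a::euclidean_space set"
  assumes Q: "polyhedron Q" "bounded Q" "interior Q \<noteq> {}"
    and cov: "\<And>F. F facet_of Q \<Longrightarrow> facet_covector Q F (nrm F) (off F)"
    and ind: "independent (nrm ` {F. F facet_of Q \<and> v \<in> F})"
    and inj: "inj_on nrm {F. F facet_of Q \<and> v \<in> F}"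
    and FG: "F facet_of Q" "G facet_of Q" "F \<noteq> G" "v \<in> F" "v \<in> G"
  shows "aff_dim (F \<inter> G) = int DIM('a) - 2"
proof -
  let ?I = "{F. F facet_of Q \<and> v \<in> F}"
  have vQ: "v \<in> Q" using FG facet_of_imp_subset by blast
  have vv: "nrm K \<bullet> v = off K" if "K \<in> ?I" for K
    using cov that by (auto simp: facet_covector_def)
  have neq: "nrm K \<noteq> nrm L" if "K \<in> ?I" "L \<in> ?I" "K \<noteq> L" for K L
    using inj that by (auto simp: inj_on_def)
  let ?L = "{x. nrm F \<bullet> x = off F} \<inter> {x. nrm G \<bullet> x = off G}"
  have "aff_dim ?L = int DIM('a) - 2"
  proof -
    obtain w where w: "\<And>a. a \<in> nrm ` ?I \<Longrightarrow> a \<bullet> w = (if a = nrm G then 1 else 0::real)"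
      using dual_vector[OF ind, of "\<lambda>a. if a = nrm G then 1 else 0"] by blast
    have "v + w \<in> {x. nrm F \<bullet> x = off F}" "v + w \<notin> {x. nrm G \<bullet> x = off G}"
      using w vv neq FG by (auto simp: inner_simps)
    moreover have "v \<in> ?L" using vv FG by auto
    moreover have "nrm F \<noteq> 0"
      using ind FG dependent_zero by (metis (mono_tags, lifting) image_eqI mem_Collect_eq)
    ultimately show ?thesis
      by (subst aff_dim_affine_Int_hyperplane) (auto simp: affine_hyperplane)
  qed
  obtain w where w: "\<And>a. a \<in> nrm ` ?I \<Longrightarrow> a \<bullet> w = (if a = nrm F \<or> a = nrm G then 0 else -1::real)"
    using dual_vector[OF ind, of "\<lambda>a. if a = nrm F \<or> a = nrm G then 0 else -1"] by blast
  obtain e where e: "e > 0"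
    "\<And>s K. \<lbrakk>\<bar>s\<bar> \<le> e; K facet_of Q; v \<notin> K\<rbrakk> \<Longrightarrow> nrm K \<bullet> (v + s *\<^sub>R w) < off K"
    using small_step_keeps_inactive[OF Q(1) vQ cov] by blast
  let ?U = "{x. \<forall>K. K facet_of Q \<and> K \<notin> {F, G} \<longrightarrow> nrm K \<bullet> x < off K}"
  have "v + e *\<^sub>R w \<in> ?L"
    using w vv FG by (auto simp: inner_simps)
  moreover have "v + e *\<^sub>R w \<in> ?U"
  proof (intro CollectI allI impI)
    fix K assume "K facet_of Q \<and> K \<notin> {F, G}"
    then have K: "K facet_of Q" "K \<notin> {F, G}" by auto
    show "nrm K \<bullet> (v + e *\<^sub>R w) < off K"
    proof (cases "v \<in> K")
      case True
      then show ?thesis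
        using K FG w[of "nrm K"] vv[of K] neq[of K F] neq[of K G] e(1) by (auto simp: inner_simps)
    qed (use e K in auto)
  qed
  ultimately have "?L \<inter> ?U \<noteq> {}" by blast
  then have dimU: "aff_dim (?L \<inter> ?U) = aff_dim ?L"
    by (intro aff_dim_convex_Int_open[OF _ inactive_facets_open[OF Q(1)]])
      (auto intro!: convex_Int convex_hyperplane)
  have "?L \<inter> ?U \<subseteq> F \<inter> G"
  proof
    fix x assume x: "x \<in> ?L \<inter> ?U"
    have "x \<in> Q"
    proof (rule mem_polyhedron_if_facet_inequalities[OF Q cov])
      show "nrm K \<bullet> x \<le> off K" if "K facet_of Q" for K
        using x that by (cases "K \<in> {F, G}") (auto intro: less_imp_le)
    qed
    then show "x \<in> F \<inter> G"
      using x cov[OF FG(1)] cov[OF FG(2)] by (auto simp: facet_covector_def)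
  qed
  moreover have "F \<inter> G \<subseteq> ?L"
    using cov[OF FG(1)] cov[OF FG(2)] by (auto simp: facet_covector_def)
  ultimately show ?thesis
    using dimU \<open>aff_dim ?L = int DIM('a) - 2\<close>
      aff_dim_subset[of "?L \<inter> ?U" "F \<inter> G"] aff_dim_subset[of "F \<inter> G" ?L] by linarith
qed

text \<open>The form \<open>a \<bullet> b - (a \<bullet> v) * (b \<bullet> v)\<close> has the Gram matrix \<open>(1 + c) I - c J\<close> in the basis \<open>S\<close>, where
\<open>J\<close> is the all-ones matrix; the eigenvalue belonging to the sum of the basis is
\<open>1 - (DIM - 1) * c\<close>.  For \<open>norm v < 1\<close> the form is positive definite, so this eigenvalue is positive.  For
\<open>norm v = 1\<close> the vector \<open>v\<close> lies in the radical; the other eigenvalue \<open>1 + c\<close> being positive, the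
radical can only come from \<open>1 - (DIM - 1) * c = 0\<close>.\<close>

lemma equiangular_basis_gram:
  fixes S :: "'a::euclidean_space set"
  assumes ind: "independent S" and card: "card S = DIM('a)" and c: "c > 0" and v: "norm v \<le> 1"
    and diag: "\<And>a. a \<in> S \<Longrightarrow> a \<bullet> a - (a \<bullet> v) * (a \<bullet> v) = 1"
    and offd: "\<And>a b. \<lbrakk>a \<in> S; b \<in> S; a \<noteq> b\<rbrakk> \<Longrightarrow> a \<bullet> b - (a \<bullet> v) * (b \<bullet> v) = - c"
  shows "norm v < 1 \<Longrightarrow> (real DIM('a) - 1) * c < 1"
    and "norm v = 1 \<Longrightarrow> (real DIM('a) - 1) * c = 1"
proof -
  have fin: "finite S" using ind independent_imp_finite by blast
  have ne: "S \<noteq> {}" using card by auto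
  have comb: "(\<Sum>a\<in>S. r a *\<^sub>R a) \<bullet> b - ((\<Sum>a\<in>S. r a *\<^sub>R a) \<bullet> v) * (b \<bullet> v)
      = (1 + c) * r b - c * (\<Sum>a\<in>S. r a)" if b: "b \<in> S" for r :: "'a \<Rightarrow> real" and b
  proof -
    have "(\<Sum>a\<in>S. r a *\<^sub>R a) \<bullet> b - ((\<Sum>a\<in>S. r a *\<^sub>R a) \<bullet> v) * (b \<bullet> v)
        = (\<Sum>a\<in>S. r a * (a \<bullet> b - (a \<bullet> v) * (b \<bullet> v)))"
      by (simp add: inner_sum_left sum_distrib_left sum_subtractf algebra_simps)
    also have "\<dots> = (\<Sum>a\<in>S. (if a = b then (1 + c) * r b else 0) - c * r a)"
    proof (intro sum.cong refl)
      fix a assume a: "a \<in> S"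
      have "a \<bullet> b - (a \<bullet> v) * (b \<bullet> v) = (if a = b then 1 else - c)"
        using diag[OF b] offd[OF a b] by simp
      then show "r a * (a \<bullet> b - (a \<bullet> v) * (b \<bullet> v)) = (if a = b then (1 + c) * r b else 0) - c * r a"
        by (simp add: algebra_simps)
    qed
    also have "\<dots> = (1 + c) * r b - c * (\<Sum>a\<in>S. r a)"
      using fin b by (simp add: sum_subtractf sum_distrib_left)
    finally show ?thesis .
  qed
  show "(real DIM('a) - 1) * c < 1" if v1: "norm v < 1"
  proof -
    define s where "s = (\<Sum>a\<in>S. 1 *\<^sub>R a)"
    have "s \<noteq> 0"
    proof
      assume "s = 0"
      obtain a0 where "a0 \<in> S" using ne by blast
      then have "(1::real) = 0"
        using independentD[OF ind fin order_refl, of "\<lambda>_. 1" a0] \<open>s = 0\<close> by (simp add: s_def)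
      then show False by simp
    qed
    have "s \<bullet> s - (s \<bullet> v) * (s \<bullet> v) = (\<Sum>b\<in>S. s \<bullet> b - (s \<bullet> v) * (b \<bullet> v))"
    proof -
      have "y \<bullet> s = (\<Sum>b\<in>S. y \<bullet> b)" for y
        by (simp add: s_def inner_sum_right)
      then show ?thesis
        by (simp add: sum_subtractf inner_commute[of _ v] flip: sum_distrib_left)
    qed
    also have "\<dots> = (\<Sum>b\<in>S. (1 + c) * 1 - c * (\<Sum>a\<in>S. 1))"
      unfolding s_def by (intro sum.cong refl comb)
    also have "\<dots> = real DIM('a) * (1 - (real DIM('a) - 1) * c)"
      by (simp add: card algebra_simps)
    finally have "s \<bullet> s - (s \<bullet> v) * (s \<bullet> v) = real DIM('a) * (1 - (real DIM('a) - 1) * c)" .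
    moreover have "s \<bullet> s - (s \<bullet> v) * (s \<bullet> v) > 0"
    proof -
      have "\<bar>s \<bullet> v\<bar> < norm s"
        using v1 \<open>s \<noteq> 0\<close> by (intro order_le_less_trans[OF Cauchy_Schwarz_ineq2]) simp
      then have "\<bar>s \<bullet> v\<bar> * \<bar>s \<bullet> v\<bar> < norm s * norm s"
        by (intro mult_strict_mono) auto
      then show ?thesis by (simp add: dot_square_norm power2_eq_square)
    qed
    ultimately show ?thesis by (simp add: zero_less_mult_iff)
  qed
  show "(real DIM('a) - 1) * c = 1" if v1: "norm v = 1"
  proof -
    have "v \<in> span S"
      using ind card card_ge_dim_independent[of S UNIV] by auto
    then obtain r where r: "v = (\<Sum>a\<in>S. r a *\<^sub>R a)"
      using fin by (auto simp: span_finite)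
    define R where "R = (\<Sum>a\<in>S. r a)"
    have eq: "(1 + c) * r b = c * R" if "b \<in> S" for b
      using comb[OF that, of r] v1 unfolding r[symmetric] R_def
      by (simp add: dot_square_norm inner_commute)
    have "(1 + c) * R = (\<Sum>b\<in>S. (1 + c) * r b)"
      by (simp add: R_def sum_distrib_left)
    also have "\<dots> = real DIM('a) * (c * R)"
      using eq card by simp
    finally have "R * (1 + c - real DIM('a) * c) = 0"
      by (simp add: algebra_simps)
    moreover have "R \<noteq> 0"
    proof
      assume "R = 0"
      then have "\<forall>b\<in>S. r b = 0" using eq c by auto
      then have "v = 0" using r by simp
      then show False using v1 by simp
    qed
    ultimately have "1 + c - real DIM('a) * c = 0"
      by simp
    then show ?thesis by (simp add: algebra_simps)
  qed
qed

text \<open>The combinatorial core.  At a point \<open>v\<close> of a facet the second component of its covector is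
\<open>a \<bullet> v\<close>, so for facets through \<open>v\<close> the Lorentz product becomes the form
\<open>a \<bullet> a' - (a \<bullet> v) * (a' \<bullet> v)\<close> in the vectors \<open>a\<close> alone.  They are pairwise obtuse for it, hence
independent; they span because \<open>v\<close> is a vertex.  So they form a basis, any two of the facets meet in
a ridge, and the Gram matrix is known completely.\<close>

proposition equiangular_polytope_vertex:
  fixes Q :: "'a::euclidean_space set"
  assumes Q: "polyhedron Q" "Q \<subseteq> cball 0 1" "interior Q \<noteq> {}" "DIM('a) \<ge> 2"
    and c: "c > 0"
    and ridge: "\<And>F G a b a' b'. \<lbrakk>F facet_of Q; G facet_of Q; aff_dim (F \<inter> G) = int DIM('a) - 2;
        facet_covector Q F a b; facet_covector Q G a' b'\<rbrakk> \<Longrightarrow> a \<bullet> a' - b * b' = - c"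
    and v: "v extreme_point_of Q"
  shows "card {F. F facet_of Q \<and> v \<in> F} = DIM('a)"
    and "norm v < 1 \<Longrightarrow> (real DIM('a) - 1) * c < 1"
    and "norm v = 1 \<Longrightarrow> (real DIM('a) - 1) * c = 1"
proof -
  have conv: "convex Q" using Q(1) polyhedron_imp_convex by blast
  have bdd: "bounded Q" using Q(2) bounded_cball bounded_subset by blast
  have dimQ: "aff_dim Q = int DIM('a)" using Q(3) by (simp add: aff_dim_nonempty_interior)
  have vQ: "v \<in> Q" using v by (simp add: extreme_point_of_def)
  then have v1: "norm v \<le> 1" using Q(2) by auto
  obtain nrm off where cov: "\<And>F. F facet_of Q \<Longrightarrow> facet_covector Q F (nrm F) (off F)"
    using facet_covector_exists[OF Q] by metis
  let ?I = "{F. F facet_of Q \<and> v \<in> F}"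
  have vv: "nrm K \<bullet> v = off K" if "K \<in> ?I" for K
    using cov that by (auto simp: facet_covector_def)
  have inj: "inj_on nrm ?I"
  proof (rule inj_onI)
    fix F G assume "F \<in> ?I" "G \<in> ?I" "nrm F = nrm G"
    moreover from this have "off F = off G" using vv by metis
    moreover have "F = Q \<inter> {x. nrm F \<bullet> x = off F}" "G = Q \<inter> {x. nrm G \<bullet> x = off G}"
      using cov \<open>F \<in> ?I\<close> \<open>G \<in> ?I\<close> by (auto simp: facet_covector_def)
    ultimately show "F = G" by simp
  qed
  have finI: "finite ?I"
    using finite_polyhedron_facets[OF Q(1)] by simp
  have obtuse: "nrm F \<bullet> nrm G - off F * off G < 0" if "F \<in> ?I" "G \<in> ?I" "F \<noteq> G" for F G
  proof (rule facet_covectors_obtuse[OF Q _ cov _ cov])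
    show "nrm F \<bullet> a' - off F * b' < 0"
      if "K facet_of Q" "aff_dim (F \<inter> K) = aff_dim Q - 2" "facet_covector Q K a' b'" for K a' b'
      using ridge[of F K "nrm F" "off F" a' b'] that dimQ \<open>F \<in> ?I\<close> cov c by auto
  qed (use that in auto)
  obtain y where y: "y \<in> interior Q" using Q(3) by blast
  have ind: "independent (nrm ` ?I)"
  proof (rule obtuse_vectors_independent[OF _ v1, of _ "y - v"])
    show "finite (nrm ` ?I)" using finI by simp
    show "a \<bullet> (y - v) < 0" if "a \<in> nrm ` ?I" for a
      using that vv facet_covector_strict_interior[OF conv Q(3) _ cov y]
      by (fastforce simp: inner_simps)
    show "a \<bullet> b - (a \<bullet> v) * (b \<bullet> v) < 0" if "a \<in> nrm ` ?I" "b \<in> nrm ` ?I" "a \<noteq> b" for a b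
      using that obtuse vv by fastforce
  qed
  have "span (nrm ` ?I) = UNIV"
  proof (rule ccontr)
    assume "span (nrm ` ?I) \<noteq> UNIV"
    then obtain w where w: "w \<noteq> 0" "\<And>x. x \<in> span (nrm ` ?I) \<Longrightarrow> w \<bullet> x = 0"
      using span_not_univ_subset_hyperplane by blast
    have "w = 0"
    proof (rule vertex_facet_normals_kernel[OF Q(1) bdd Q(3) cov v])
      show "nrm F \<bullet> w = 0" if "F facet_of Q" "v \<in> F" for F
        using that w(2)[OF span_base, of "nrm F"] by (simp add: inner_commute)
    qed
    then show False using w by simp
  qed
  then have card: "card (nrm ` ?I) = DIM('a)"
    using ind by (metis dim_UNIV dim_span_eq_card_independent)
  then show "card ?I = DIM('a)"
    using inj by (simp add: card_image)
  have diag: "a \<bullet> a - (a \<bullet> v) * (a \<bullet> v) = 1" if "a \<in> nrm ` ?I" for a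
    using that cov vv by (auto simp: facet_covector_def)
  have offd: "a \<bullet> b - (a \<bullet> v) * (b \<bullet> v) = - c" if ab: "a \<in> nrm ` ?I" "b \<in> nrm ` ?I" "a \<noteq> b" for a b
  proof -
    obtain F G where FG: "F \<in> ?I" "G \<in> ?I" "a = nrm F" "b = nrm G" "F \<noteq> G"
      using ab by blast
    have "aff_dim (F \<inter> G) = int DIM('a) - 2"
      using FG by (intro independent_facets_meet_in_ridge[OF Q(1) bdd Q(3) cov ind inj]) auto
    then have "nrm F \<bullet> nrm G - off F * off G = - c"
      using FG cov ridge by blast
    then show ?thesis using FG vv by metis
  qed
  show "norm v < 1 \<Longrightarrow> (real DIM('a) - 1) * c < 1"
    and "norm v = 1 \<Longrightarrow> (real DIM('a) - 1) * c = 1"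
    using equiangular_basis_gram[OF ind card c v1 diag offd] by blast+
qed

section \<open>Angles in the Klein model\<close>

lemma klein_inner_add_left: "klein_inner x (u + v) w = klein_inner x u w + klein_inner x v w"
  by (simp add: klein_inner_def inner_simps add_divide_distrib distrib_right algebra_simps)

lemma klein_inner_scale_left: "klein_inner x (c *\<^sub>R u) w = c * klein_inner x u w"
  by (simp add: klein_inner_def algebra_simps)

lemma klein_inner_commute: "klein_inner x u w = klein_inner x w u"
  by (simp add: klein_inner_def inner_commute mult.commute)

lemma klein_inner_diff_left: "klein_inner x (u - v) w = klein_inner x u w - klein_inner x v w"
  using klein_inner_add_left[of x "u - v" v w] by simp

lemma klein_inner_self_pos:
  assumes "norm x < 1" "u \<noteq> 0"
  shows "klein_inner x u u > 0"
proof -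
  have "1 - (norm x)\<^sup>2 > 0"
    using assms by (simp add: abs_square_less_1)
  then show ?thesis
    using assms unfolding klein_inner_def
    by (intro add_pos_nonneg divide_pos_pos divide_nonneg_pos) auto
qed

lemma klein_inner_unit_bound:
  assumes "norm x < 1" "klein_inner x u u = 1" "klein_inner x w w = 1"
  shows "\<bar>klein_inner x u w\<bar> \<le> 1"
proof -
  have nonneg: "klein_inner x y y \<ge> 0" for y
    using klein_inner_self_pos[OF assms(1), of y] by (cases "y = 0") (auto simp: klein_inner_def)
  have "klein_inner x (u - w) (u - w) = 2 - 2 * klein_inner x u w"
    using assms by (simp add: klein_inner_diff_left klein_inner_commute[of x _ "u - w"])
      (simp add: klein_inner_diff_left klein_inner_commute[of x w u])
  moreover have "klein_inner x (u + w) (u + w) = 2 + 2 * klein_inner x u w"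
    using assms by (simp add: klein_inner_add_left klein_inner_commute[of x _ "u + w"])
      (simp add: klein_inner_add_left klein_inner_commute[of x w u])
  ultimately show ?thesis
    using nonneg[of "u - w"] nonneg[of "u + w"] by (simp add: abs_le_iff)
qed

text \<open>The inverse metric at \<open>x\<close> sends the covector \<open>a\<close> to \<open>(1 - (norm x)\<^sup>2) *\<^sub>R (a - (x \<bullet> a) *\<^sub>R x)\<close>; the
square root makes the length one when \<open>a \<bullet> a - b * b = 1\<close>.\<close>

definition klein_normal :: "real^4 \<Rightarrow> real \<Rightarrow> real^4 \<Rightarrow> real^4" where
  "klein_normal a b x = sqrt (1 - (norm x)\<^sup>2) *\<^sub>R (a - b *\<^sub>R x)"

lemma klein_inner_normal:
  assumes "norm x < 1" "a \<bullet> x = b"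
  shows "klein_inner x (klein_normal a b x) w = (a \<bullet> w) / sqrt (1 - (norm x)\<^sup>2)"
proof -
  define s where "s = 1 - (norm x)\<^sup>2"
  have s: "s > 0"
    using assms by (simp add: s_def abs_square_less_1)
  have xx: "x \<bullet> x = 1 - s"
    by (simp add: s_def dot_square_norm)
  have "klein_inner x (a - b *\<^sub>R x) w
      = (a \<bullet> w - b * (x \<bullet> w)) / s + (b - b * (1 - s)) * (x \<bullet> w) / s\<^sup>2"
    using assms(2) by (simp add: klein_inner_def inner_simps xx inner_commute[of x a] flip: s_def)
  also have "\<dots> = (a \<bullet> w) / s"
    using s by (simp add: field_simps power2_eq_square)
  finally have "klein_inner x (klein_normal a b x) w = sqrt s * ((a \<bullet> w) / s)"
    by (simp add: klein_normal_def klein_inner_scale_left flip: s_def)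
  also have "\<dots> = (a \<bullet> w) / sqrt s"
    using s by (simp add: field_simps flip: power2_eq_square)
  finally show ?thesis by (simp add: s_def)
qed

text \<open>The link between angles and Lorentz products: the right-hand side does not depend on \<open>x\<close>.\<close>

lemma klein_inner_normal_normal:
  assumes "norm x < 1" "a \<bullet> x = b" "a' \<bullet> x = b'"
  shows "klein_inner x (klein_normal a b x) (klein_normal a' b' x) = a \<bullet> a' - b * b'"
proof -
  have "1 - (norm x)\<^sup>2 > 0"
    using assms by (simp add: abs_square_less_1)
  then show ?thesis
    unfolding klein_inner_normal[OF assms(1,2)]
    using assms by (simp add: klein_normal_def inner_simps mult.commute)
qed

text \<open>For uniqueness, a vector \<open>n\<close> with the required properties is represented by the Euclidean covector
\<open>m\<close> with \<open>klein_inner x n w = m \<bullet> w\<close>.  As \<open>m\<close> vanishes on the directions of the facet, it is a multiple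
of \<open>a\<close>; the length fixes the factor up to sign, and the point \<open>y0\<close> inside the half-space fixes the sign.\<close>

lemma outward_normal_eq_klein_normal:
  fixes P :: "(real^4) set"
  assumes F: "F = P \<inter> {y. a \<bullet> y = b}" "aff_dim F = 3"
    and P: "P \<subseteq> {y. a \<bullet> y \<le> b}" and unit: "a \<bullet> a - b * b = 1"
    and y0: "y0 \<in> P" "a \<bullet> y0 < b" and x: "x \<in> F" "norm x < 1"
  shows "outward_normal P F x = klein_normal a b x"
  unfolding outward_normal_def
proof (rule the_equality)
  have ax: "a \<bullet> x = b" using x F by auto
  have s: "1 - (norm x)\<^sup>2 > 0"
    using x by (simp add: abs_square_less_1)
  let ?n = "klein_normal a b x"
  have nw: "klein_inner x ?n w = (a \<bullet> w) / sqrt (1 - (norm x)\<^sup>2)" for w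
    by (rule klein_inner_normal[OF x(2) ax])
  have nn: "klein_inner x ?n ?n = 1"
    using klein_inner_normal_normal[OF x(2) ax ax] unit by simp
  have "\<forall>y\<in>F. klein_inner x ?n (y - x) = 0"
    using F(1) ax by (simp add: nw inner_diff_right)
  moreover have "\<forall>y\<in>P. klein_inner x ?n (y - x) \<le> 0"
    using P ax s by (auto simp: nw inner_diff_right divide_le_0_iff)
  ultimately show "klein_inner x ?n ?n = 1 \<and> (\<forall>y\<in>F. klein_inner x ?n (y - x) = 0) \<and>
      (\<forall>y\<in>P. klein_inner x ?n (y - x) \<le> 0)"
    using nn by blast
  fix n
  assume n: "klein_inner x n n = 1 \<and> (\<forall>y\<in>F. klein_inner x n (y - x) = 0) \<and>
      (\<forall>y\<in>P. klein_inner x n (y - x) \<le> 0)"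
  define m where "m = n /\<^sub>R (1 - (norm x)\<^sup>2) + ((x \<bullet> n) / (1 - (norm x)\<^sup>2)\<^sup>2) *\<^sub>R x"
  have mw: "klein_inner x n w = m \<bullet> w" for w
    by (simp add: klein_inner_def m_def inner_simps divide_inverse mult.commute)
  have "a \<noteq> 0"
    using y0 ax by auto
  have "F \<subseteq> {y. m \<bullet> y = m \<bullet> x}"
    using n by (auto simp: mw inner_diff_right)
  then have "affine hull F \<subseteq> {y. m \<bullet> y = m \<bullet> x}"
    by (intro hull_minimal) (auto simp: affine_hyperplane)
  have "affine hull F = {y. a \<bullet> y = b}"
    using F x \<open>a \<noteq> 0\<close> by (intro affine_hull_hyperplane_eq) auto
  have sub: "m \<bullet> w = 0" if "a \<bullet> w = 0" for w
  proof -
    have "x + w \<in> {y. a \<bullet> y = b}"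
      using that ax by (simp add: inner_add_right)
    then have "x + w \<in> {y. m \<bullet> y = m \<bullet> x}"
      using \<open>affine hull F \<subseteq> {y. m \<bullet> y = m \<bullet> x}\<close> \<open>affine hull F = {y. a \<bullet> y = b}\<close> by blast
    then show ?thesis by (simp add: inner_add_right)
  qed
  define l where "l = (m \<bullet> a) / (a \<bullet> a)"
  have "a \<bullet> (m - l *\<^sub>R a) = 0"
    using \<open>a \<noteq> 0\<close> by (simp add: l_def inner_simps inner_commute)
  from this sub[OF this] have "(m - l *\<^sub>R a) \<bullet> (m - l *\<^sub>R a) = 0"
    by (simp add: inner_diff_left)
  then have ml: "m = l *\<^sub>R a" by simp
  define k where "k = l * sqrt (1 - (norm x)\<^sup>2)"
  have "klein_inner x (n - k *\<^sub>R ?n) w = 0" for w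
    using s by (simp add: klein_inner_diff_left klein_inner_scale_left nw mw ml k_def)
  then have nk: "n = k *\<^sub>R ?n"
    using klein_inner_self_pos[OF x(2), of "n - k *\<^sub>R ?n"] by force
  have "k * k = 1"
    using n nn unfolding nk
    by (simp add: klein_inner_scale_left klein_inner_commute[of x _ "k *\<^sub>R ?n"])
  moreover have "k \<ge> 0"
  proof -
    have "k * (klein_inner x ?n (y0 - x)) \<le> 0"
      using n y0(1) unfolding nk by (simp add: klein_inner_scale_left)
    moreover have "klein_inner x ?n (y0 - x) < 0"
      using y0(2) ax s by (simp add: nw inner_diff_right divide_less_0_iff)
    ultimately show ?thesis by (simp add: mult_le_0_iff)
  qed
  ultimately have "k = 1"
    by (metis abs_of_nonneg abs_mult_self_eq mult_1 power2_eq_iff_nonneg power2_eq_square zero_le_one)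
  then show "n = ?n" using nk by simp
qed

lemma dihedral_angle_imp_inner:
  fixes P :: "(real^4) set"
  assumes F: "F = P \<inter> {y. a \<bullet> y = b}" "aff_dim F = 3" "P \<subseteq> {y. a \<bullet> y \<le> b}" "a \<bullet> a - b * b = 1"
    and G: "G = P \<inter> {y. a' \<bullet> y = b'}" "aff_dim G = 3" "P \<subseteq> {y. a' \<bullet> y \<le> b'}" "a' \<bullet> a' - b' * b' = 1"
    and y0: "y0 \<in> P" "a \<bullet> y0 < b" "a' \<bullet> y0 < b'" and x: "x \<in> F \<inter> G" "norm x < 1"
    and ang: "dihedral_angle_at P F G x = \<alpha>"
  shows "a \<bullet> a' - b * b' = - cos \<alpha>"
proof -
  have ax: "a \<bullet> x = b" "a' \<bullet> x = b'" using x F(1) G(1) by auto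
  let ?k = "a \<bullet> a' - b * b'"
  have n: "outward_normal P F x = klein_normal a b x" "outward_normal P G x = klein_normal a' b' x"
    using outward_normal_eq_klein_normal[OF F y0(1,2)] outward_normal_eq_klein_normal[OF G y0(1,3)] x
    by auto
  have k: "klein_inner x (klein_normal a b x) (klein_normal a' b' x) = ?k"
    by (rule klein_inner_normal_normal[OF x(2) ax])
  have "klein_inner x (klein_normal a b x) (klein_normal a b x) = 1"
       "klein_inner x (klein_normal a' b' x) (klein_normal a' b' x) = 1"
    using klein_inner_normal_normal[OF x(2) ax(1,1)] klein_inner_normal_normal[OF x(2) ax(2,2)] F(4) G(4)
    by auto
  then have "\<bar>?k\<bar> \<le> 1"
    using klein_inner_unit_bound[OF x(2)] k by metis
  then have "?k = cos (arccos ?k)"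
    by (simp add: abs_le_iff cos_arccos)
  also have "arccos ?k = pi - \<alpha>"
    using ang by (simp add: dihedral_angle_at_def n k)
  finally show ?thesis by simp
qed

section \<open>Facets of the hyperbolic part\<close>

text \<open>Passing from a polytope in the closed ball to its part in hyperbolic space loses nothing of a facet:
the facet has a relative interior point in the open ball, so it is recovered as a closure.\<close>

lemma facet_Int_ball:
  fixes Q :: "'a::euclidean_space set"
  assumes Q: "polyhedron Q" "Q \<subseteq> cball 0 1" "interior Q \<noteq> {}" "DIM('a) \<ge> 2" and F: "F facet_of Q"
  shows "F \<inter> ball 0 1 facet_of Q \<inter> ball 0 1" "closure (F \<inter> ball 0 1) = F"
    "aff_dim (F \<inter> ball 0 1) = int DIM('a) - 1"
proof -
  have dimQ: "aff_dim Q = int DIM('a)" using Q(3) by (simp add: aff_dim_nonempty_interior)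
  have convF: "convex F" and FQ: "F \<subseteq> Q"
    using F face_of_imp_convex facet_of_imp_face_of facet_of_imp_subset by blast+
  have dimF: "aff_dim F = int DIM('a) - 1" using F dimQ by (simp add: facet_of_def)
  obtain m where m: "m \<in> F" "norm m < 1"
  proof (rule convex_meets_ball[OF convF])
    show "F \<subseteq> cball 0 1" using FQ Q(2) by blast
    show "1 \<le> aff_dim F" using dimF Q(4) by linarith
  qed
  then have Fm: "F \<inter> ball 0 1 \<noteq> {}" by auto
  show dim: "aff_dim (F \<inter> ball 0 1) = int DIM('a) - 1"
    using aff_dim_convex_Int_open[OF convF open_ball Fm] dimF by simp
  have "Q \<inter> ball 0 1 \<noteq> {}" using Fm FQ by blast
  then have dimP: "aff_dim (Q \<inter> ball 0 1) = int DIM('a)"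
    using aff_dim_convex_Int_open[OF polyhedron_imp_convex[OF Q(1)] open_ball] dimQ by simp
  show "F \<inter> ball 0 1 facet_of Q \<inter> ball 0 1"
    unfolding facet_of_def using face_of_slice[OF facet_of_imp_face_of[OF F] convex_ball] Fm dim dimP
    by auto
  have "closed F"
    using F Q(1) face_of_polyhedron_polyhedron facet_of_imp_face_of polyhedron_imp_closed by blast
  have "m \<in> closure (rel_interior F)"
    using m(1) convex_closure_rel_interior[OF convF] closure_subset by blast
  moreover have "m \<in> ball 0 1" using m(2) by simp
  ultimately have "rel_interior F \<inter> ball 0 1 \<noteq> {}"
    by (metis Int_commute disjoint_iff open_Int_closure_eq_empty open_ball)
  then have "closure (F \<inter> ball 0 1) = closure F \<inter> closure (ball 0 1)"
    using closure_Int_convex[OF convF convex_ball[of 0 1]] rel_interior_open[OF open_ball[of "0::'a" 1]]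
    by simp
  then show "closure (F \<inter> ball 0 1) = F"
    using \<open>closed F\<close> FQ Q(2) by auto
qed

text \<open>A relative interior point of \<open>F\<close> lies on the boundary of \<open>Q\<close>, hence in a facet of \<open>Q\<close>.  The trace of
that facet in the ball is a facet that contains \<open>F\<close>, hence equals it.\<close>

lemma facet_of_Int_ball_imp:
  fixes Q :: "'a::euclidean_space set"
  assumes Q: "polyhedron Q" "Q \<subseteq> cball 0 1" "interior Q \<noteq> {}" "DIM('a) \<ge> 2"
    and F: "F facet_of Q \<inter> ball 0 1"
  obtains F' where "F' facet_of Q" "F = F' \<inter> ball 0 1"
proof -
  have convQ: "convex Q" using Q(1) polyhedron_imp_convex by blast
  have convF: "convex F" and FQ: "F \<subseteq> Q \<inter> ball 0 1" and ne: "F \<noteq> {}"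
    using F face_of_imp_convex facet_of_imp_face_of facet_of_imp_subset facet_of_def by blast+
  obtain x where x: "x \<in> rel_interior F"
    using convF ne rel_interior_eq_empty by blast
  then have xF: "x \<in> F" using rel_interior_subset by blast
  have "F \<noteq> Q \<inter> ball 0 1" using F facet_of_irrefl by blast
  then have "x \<notin> interior (Q \<inter> ball 0 1)"
    using face_of_disjoint_interior[OF facet_of_imp_face_of[OF F]] xF by blast
  then have "x \<notin> interior Q"
    using xF FQ by (auto simp: interior_open)
  then have "x \<in> Q - rel_interior Q"
    using xF FQ rel_interior_nonempty_interior[OF Q(3)] by auto
  then obtain F' where F': "F' facet_of Q" "x \<in> F'"
    using rel_boundary_of_polyhedron[OF Q(1)] by blast
  let ?G = "F' \<inter> ball 0 1"
  have G: "?G facet_of Q \<inter> ball 0 1"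
    by (rule facet_Int_ball(1)[OF Q F'(1)])
  have "F \<subseteq> ?G"
  proof (rule subset_of_face_of[OF facet_of_imp_face_of[OF G]])
    show "F \<subseteq> Q \<inter> ball 0 1" by (rule FQ)
    show "?G \<inter> rel_interior F \<noteq> {}" using x xF F'(2) FQ by auto
  qed
  then have "F = ?G"
    by (intro facets_antichain[OF convex_Int[OF convQ convex_ball] F G])
  then show ?thesis using that F'(1) by blast
qed

section \<open>Finite volume\<close>

text \<open>A set closed under shrinking towards the origin contains its image under \<open>x \<mapsto> r *\<^sub>R x\<close>, which has \<open>r ^ 4\<close>
times its volume.\<close>

lemma emeasure_cone_shell:
  fixes C :: "(real^4) set"
  assumes C: "open C" "C \<noteq> {}" "C \<subseteq> ball 0 1"
    and cone: "\<And>x r. \<lbrakk>x \<in> C; 0 < r; r \<le> 1\<rbrakk> \<Longrightarrow> r *\<^sub>R x \<in> C"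
    and r: "0 < r" "r < 1"
  shows "measure lborel C > 0"
    and "C - (\<lambda>x. r *\<^sub>R x) ` C \<in> sets lborel"
    and "emeasure lborel (C - (\<lambda>x. r *\<^sub>R x) ` C) = ennreal ((1 - r ^ 4) * measure lborel C)"
proof -
  let ?rC = "(\<lambda>x. r *\<^sub>R x) ` C"
  have op: "open ?rC" using C(1) r by (intro open_scaling) auto
  have sub: "?rC \<subseteq> C" using cone r by auto
  have bdd: "bounded C" using C(3) bounded_ball bounded_subset by blast
  have lmC: "C \<in> lmeasurable" using C(1) bdd lmeasurable_open by blast
  have lmrC: "?rC \<in> lmeasurable" using op bdd sub bounded_subset lmeasurable_open by blast
  show m: "measure lborel C > 0"
    using open_not_negligible[OF C(1,2)] negligible_iff_measure[of C] lmC C(1)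
    by (simp add: zero_less_measure_iff)
  show sets: "C - ?rC \<in> sets lborel" using C(1) op by auto
  have "measure lebesgue ?rC = r ^ 4 * measure lebesgue C"
    using measure_lebesgue_affine[of r "0::real^4" C] r by simp
  then have "measure lebesgue (C - ?rC) = (1 - r ^ 4) * measure lebesgue C"
    using measurable_measure_Diff[OF lmC _ sub] lmrC by (simp add: fmeasurableD algebra_simps)
  moreover have "emeasure lebesgue (C - ?rC) = ennreal (measure lebesgue (C - ?rC))"
    using fmeasurable.Diff[OF lmC lmrC] by (simp add: emeasure_eq_measure2)
  ultimately show "emeasure lborel (C - ?rC) = ennreal ((1 - r ^ 4) * measure lborel C)"
    using sets C(1) by simp
qed

text \<open>In the part at distance at most \<open>1 / n\<close> from the sphere of a thin cone around \<open>z\<close>, the Lebesgue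
measure is at least a constant times \<open>1 / n\<close>, while the density is at least \<open>n\<^sup>2 / 4\<close>; the exponent
\<open>5 / 2\<close> is weakened to \<open>2\<close>, which suffices.\<close>

lemma hyp_volume_near_infinity:
  fixes z :: "real^4"
  assumes z: "norm z = 1" and e: "0 < e" "ball z e \<inter> ball 0 1 \<subseteq> P" and P: "P \<in> sets borel" "P \<subseteq> ball 0 1"
  shows "emeasure hyp_volume P = \<infinity>"
proof (rule ccontr)
  assume fin: "emeasure hyp_volume P \<noteq> \<infinity>"
  \<comment> \<open>The opening of the cone: points of the cone within e/2 of the sphere are then at distance
    less than e from z.\<close>
  define k where "k = 1 - (min e 1)\<^sup>2 / 8"
  have k: "0 < k" "k < 1" "2 * (1 - k) \<le> e\<^sup>2 / 4"
  proof -
    have "(min e 1)\<^sup>2 \<le> 1" "(min e 1)\<^sup>2 \<le> e\<^sup>2" "(min e 1)\<^sup>2 > 0"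
      using e(1) by (auto intro!: power_le_one power_mono)
    then show "0 < k" "k < 1" "2 * (1 - k) \<le> e\<^sup>2 / 4" by (auto simp: k_def)
  qed
  define C where "C = {x. k * norm x < x \<bullet> z} \<inter> ball 0 1"
  have C1: "open C"
    unfolding C_def by (intro open_Int open_ball open_Collect_less continuous_intros)
  have "(1/2) *\<^sub>R z \<in> C"
    using z k by (simp add: C_def dot_square_norm)
  then have C2: "C \<noteq> {}" by blast
  have C3: "C \<subseteq> ball 0 1" by (simp add: C_def)
  have C4: "r *\<^sub>R x \<in> C" if x: "x \<in> C" and r: "0 < r" "r \<le> 1" for x r
  proof -
    have "k * norm (r *\<^sub>R x) < (r *\<^sub>R x) \<bullet> z"
      using x r mult_strict_left_mono[of "k * norm x" "x \<bullet> z" r] by (simp add: C_def mult_ac)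
    moreover have "norm (r *\<^sub>R x) < 1"
      using x r mult_le_less_imp_less[of r 1 "norm x" 1]  by (cases "x = 0") (auto simp: C_def)
    ultimately show ?thesis by (simp add: C_def)
  qed
  define V where "V = enn2real (emeasure hyp_volume P)"
  have V: "emeasure hyp_volume P = ennreal V" "V \<ge> 0"
    using fin by (auto simp: V_def less_top)
  have bound: "real n * measure lborel C / 4 \<le> V" if n: "n \<ge> 2" "2 / real n < e" for n
  proof -
    define r where "r = 1 - 1 / real n"
    have r: "0 < r" "r < 1" using n by (auto simp: r_def)
    let ?S = "C - (\<lambda>x. r *\<^sub>R x) ` C"
    note S = emeasure_cone_shell[OF C1 C2 C3 C4 r]
    have radius: "r \<le> norm x" "norm x < 1" if "x \<in> ?S" for x
    proof -
      show "norm x < 1" using that C3 by auto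
      show "r \<le> norm x"
      proof (rule ccontr)
        assume "\<not> r \<le> norm x"
        then have "norm (x /\<^sub>R r) < 1" using r by (simp add: field_simps)
        moreover have "k * norm (x /\<^sub>R r) < (x /\<^sub>R r) \<bullet> z"
          using that r by (auto simp: C_def divide_simps)
        ultimately have "x /\<^sub>R r \<in> C" by (simp add: C_def)
        then have "r *\<^sub>R (x /\<^sub>R r) \<in> (\<lambda>x. r *\<^sub>R x) ` C" by blast
        then show False using that r by simp
      qed
    qed
    have "?S \<subseteq> P"
    proof
      fix x assume x: "x \<in> ?S"
      have "(norm (x - z))\<^sup>2 = (norm x)\<^sup>2 + 1 - 2 * (x \<bullet> z)"
        using z by (simp add: power2_norm_eq_inner inner_simps inner_commute)
          (simp add: dot_square_norm)
      also have "\<dots> \<le> (norm x)\<^sup>2 + 1 - 2 * (k * norm x)"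
        using x by (simp add: C_def)
      also have "\<dots> = (1 - norm x)\<^sup>2 + norm x * (2 * (1 - k))"
        by (simp add: power2_eq_square algebra_simps)
      also have "\<dots> \<le> (1 - r)\<^sup>2 + 1 * (2 * (1 - k))"
        using radius[OF x] k r by (intro add_mono power_mono mult_right_mono) auto
      also have "\<dots> < (e / 2)\<^sup>2 + e\<^sup>2 / 4"
      proof (intro add_less_le_mono power_strict_mono)
        show "1 - r < e / 2" using n by (simp add: r_def)
      qed (use k r in auto)
      also have "\<dots> \<le> e\<^sup>2" by (simp add: power2_eq_square)
      finally have "norm (x - z) < e" using e(1) by (simp add: power2_less_imp_less)
      then show "x \<in> P" using e(2) radius[OF x] by (auto simp: dist_norm norm_minus_commute)
    qed
    have dens: "ennreal ((real n)\<^sup>2 / 4) \<le>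
        (if x \<in> hyp_space then ennreal ((1 - (norm x)\<^sup>2) powr (- 5 / 2)) else 0)" if x: "x \<in> ?S" for x
    proof -
      have x1: "norm x < 1" "r \<le> norm x" using radius[OF x] by auto
      define t where "t = 1 - (norm x)\<^sup>2"
      have t: "0 < t" using x1 by (simp add: t_def abs_square_less_1)
      have "t = (1 - norm x) * (1 + norm x)" by (simp add: t_def power2_eq_square algebra_simps)
      also have "\<dots> \<le> (1 - r) * 2" using x1 r by (intro mult_mono) auto
      finally have t2: "t \<le> 2 / real n" by (simp add: r_def)
      also have "\<dots> \<le> 1" using n by simp
      finally have t1: "t \<le> 1" .
      have "(real n)\<^sup>2 / 4 = (2 / real n) powr (-2)"
        using n by (simp add: powr_minus powr_numeral power2_eq_square field_simps)
      also have "\<dots> \<le> t powr (-2)" using t t2 by (intro powr_mono2') auto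
      also have "\<dots> \<le> t powr (- 5 / 2)" using t t1 by (intro powr_mono') auto
      finally show ?thesis using x1 by (simp add: t_def ennreal_leI)
    qed
    have "ennreal (real n * measure lborel C / 4) \<le> ennreal ((real n)\<^sup>2 / 4) * emeasure lborel ?S"
    proof -
      have "r ^ 4 \<le> r ^ 1" using r by (intro power_decreasing) auto
      then have "1 / real n \<le> 1 - r ^ 4" by (simp add: r_def)
      then have "(real n)\<^sup>2 / 4 * (1 / real n * measure lborel C) \<le> (real n)\<^sup>2 / 4 * ((1 - r ^ 4) * measure lborel C)"
        by (intro mult_left_mono mult_right_mono) auto
      moreover have "(real n)\<^sup>2 / 4 * (1 / real n * measure lborel C) = real n * measure lborel C / 4"
        using n by (simp add: power2_eq_square)
      ultimately show ?thesis
        by (simp add: S(3) ennreal_mult'[symmetric] ennreal_leI)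
    qed
    also have "\<dots> = (\<integral>\<^sup>+x. ennreal ((real n)\<^sup>2 / 4) * indicator ?S x \<partial>lborel)"
      using S(2) by (simp add: nn_integral_cmult_indicator)
    also have "\<dots> \<le> (\<integral>\<^sup>+x. (if x \<in> hyp_space then ennreal ((1 - (norm x)\<^sup>2) powr (- 5 / 2)) else 0)
        * indicator P x \<partial>lborel)"
    proof (rule nn_integral_mono)
      fix x
      show "ennreal ((real n)\<^sup>2 / 4) * indicator ?S x \<le>
          (if x \<in> hyp_space then ennreal ((1 - (norm x)\<^sup>2) powr (- 5 / 2)) else 0) * indicator P x"
        using dens[of x] \<open>?S \<subseteq> P\<close> by (cases "x \<in> ?S") (auto split: split_indicator)
    qed
    also have "\<dots> = emeasure hyp_volume P"
      unfolding hyp_volume_def using P(1) by (subst emeasure_density) auto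
    finally show ?thesis using V by (simp add: ennreal_le_iff)
  qed
  have m: "measure lborel C > 0"
    using emeasure_cone_shell(1)[OF C1 C2 C3 C4, of "1/2"] by simp
  obtain n :: nat where n: "real n > 2 + 2 / e + 4 * V / measure lborel C"
    using reals_Archimedean2 by blast
  have "2 / e \<ge> 0" "4 * V / measure lborel C \<ge> 0" using e(1) V m by auto
  then have "n \<ge> 2" "2 / e < real n" "4 * V / measure lborel C < real n"
    using n by linarith+
  then show False
    using bound[of n] m e(1) by (simp add: field_simps)
qed

text \<open>Otherwise a segment from an interior point of the polytope to a point outside the closed ball would
cross the sphere in an interior point of \<open>Q\<close>, near which the volume is infinite.\<close>

lemma finite_volume_imp_bounded_by_sphere:
  fixes Q :: "(real^4) set"
  assumes "closed Q" "convex Q" "interior (Q \<inter> hyp_space) \<noteq> {}" "finite_volume (Q \<inter> hyp_space)"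
  shows "Q \<subseteq> cball 0 1"
proof (rule ccontr)
  assume "\<not> Q \<subseteq> cball 0 1"
  then obtain y where y: "y \<in> Q" "norm y > 1" by force
  obtain p where p: "p \<in> interior Q" "norm p < 1"
    using assms(3) by (auto simp: interior_open)
  have "closed_segment p y \<inter> frontier (ball 0 1) \<noteq> {}"
  proof (rule connected_Int_frontier)
    show "closed_segment p y \<inter> ball 0 1 \<noteq> {}" using p by auto
    show "closed_segment p y - ball 0 1 \<noteq> {}"
      using y by (metis Diff_iff empty_iff ends_in_segment(2) mem_ball_0 not_less_iff_gr_or_eq)
  qed simp
  then obtain z where z: "z \<in> closed_segment p y" "norm z = 1"
    by auto
  then have "z \<in> open_segment p y"
    using p y by (auto simp: open_segment_def)
  then have "z \<in> interior Q"
    using in_interior_closure_convex_segment[OF assms(2) p(1), of y] y(1) closure_subset by blast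
  then obtain e where e: "e > 0" "ball z e \<subseteq> Q"
    by (meson mem_interior)
  have "emeasure hyp_volume (Q \<inter> hyp_space) = \<infinity>"
    by (rule hyp_volume_near_infinity[OF z(2) e(1)]) (use e(2) assms(1) in auto)
  then show False using assms(4) by (simp add: finite_volume_def)
qed

section \<open>Equiangular polytopes in hyperbolic 4-space\<close>

theorem proposition2p1:
  fixes P :: "(real^4) set" and \<alpha> :: real
  assumes "hyp_polytope P"
    and "finite_volume P"
    and "0 < \<alpha>" and "\<alpha> < pi / 2"
    and "all_dihedral_angles P \<alpha>"
  shows "simple_hyp_polytope P \<and>
    \<alpha> \<ge> arccos (1 / 3) \<and>
    (\<alpha> = arccos (1 / 3) \<longrightarrow> vertices P \<subseteq> sphere_at_infinity) \<and>
    (\<alpha> > arccos (1 / 3) \<longrightarrow> vertices P \<subseteq> hyp_space \<and> compact P)"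
proof -
  obtain \<H> where H: "finite \<H>" "\<And>H. H \<in> \<H> \<Longrightarrow> hyp_halfspace H" "P = hyp_space \<inter> \<Inter>\<H>"
    and intP: "interior P \<noteq> {}"
    using assms(1) unfolding hyp_polytope_def by metis
  have "\<forall>H\<in>\<H>. \<exists>n. H = {x \<in> hyp_space. fst n \<bullet> x \<le> snd n}"
    using H(2) by (force simp: hyp_halfspace_def)
  from bchoice[OF this] obtain n where n: "\<forall>H\<in>\<H>. H = {x \<in> hyp_space. fst (n H) \<bullet> x \<le> snd (n H)}"
    by blast
  \<comment> \<open>Q is the Euclidean polyhedron cut out by the same inequalities; it turns out to be the
    closure of P.\<close>
  define Q where "Q = (\<Inter>H\<in>\<H>. {x. fst (n H) \<bullet> x \<le> snd (n H)})"
  have poly: "polyhedron Q"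
    unfolding Q_def using H(1) by (intro polyhedron_Inter) (auto simp: polyhedron_halfspace_le)
  have PQ: "P = Q \<inter> hyp_space"
    using H(3) n by (fastforce simp: Q_def)
  have conv: "convex Q" and clos: "closed Q"
    using poly polyhedron_imp_convex polyhedron_imp_closed by blast+
  have QB: "Q \<subseteq> cball 0 1"
    by (rule finite_volume_imp_bounded_by_sphere[OF clos conv]) (use intP assms(2) PQ in auto)
  have intQ: "interior Q \<noteq> {}"
    using intP PQ interior_mono[of P Q] by auto
  have comp: "compact Q"
    using clos QB bounded_subset compact_eq_bounded_closed bounded_cball by blast
  note Q = poly QB intQ
  have dim: "DIM(real^4) \<ge> 2" "int DIM(real^4) = 4" by auto
  have intQ_ball: "interior Q \<subseteq> hyp_space"
    using interior_mono[OF QB] by simp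
  have closP: "closure P = Q"
  proof
    show "closure P \<subseteq> Q" using PQ clos by (simp add: closure_minimal)
    have "interior Q \<subseteq> P" using intQ_ball interior_subset PQ by blast
    then have "closure (interior Q) \<subseteq> closure P" by (rule closure_mono)
    then show "Q \<subseteq> closure P"
      using convex_closure_interior[OF conv intQ] clos by simp
  qed
  have verts: "vertices P = {v. v extreme_point_of Q}"
    by (simp add: vertices_def closP)
  define c where "c = cos \<alpha>"
  have c: "c > 0" using assms(3,4) by (simp add: c_def cos_gt_zero)
  \<comment> \<open>A ridge of Q has a point in hyperbolic space, at which the hypothesis on angles can be read off.\<close>
  have ridge: "a \<bullet> a' - b * b' = - c"
    if FG: "F facet_of Q" "G facet_of Q" "aff_dim (F \<inter> G) = int DIM(real^4) - 2"
      and Fa: "facet_covector Q F a b" and Ga: "facet_covector Q G a' b'" for F G a b a' b'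
  proof -
    let ?F = "F \<inter> hyp_space" and ?G = "G \<inter> hyp_space"
    have dFG: "aff_dim (F \<inter> G) = 2" using FG(3) by simp
    have convFG: "convex (F \<inter> G)"
      using FG face_of_imp_convex facet_of_imp_face_of by (blast intro: convex_Int)
    have FGB: "F \<inter> G \<subseteq> cball 0 1" using FG(1) facet_of_imp_subset QB by blast
    obtain x where x: "x \<in> F \<inter> G" "norm x < 1"
      using convex_meets_ball[OF convFG FGB] dFG by auto
    have xFG: "x \<in> ?F \<inter> ?G" using x by auto
    have "F \<inter> G \<inter> hyp_space \<noteq> {}" using x by auto
    then have "aff_dim (F \<inter> G \<inter> hyp_space) = 2"
      using aff_dim_convex_Int_open[OF convFG open_ball] dFG by metis
    moreover have "?F \<inter> ?G = F \<inter> G \<inter> hyp_space" by blast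
    ultimately have d: "aff_dim (?F \<inter> ?G) = 2" by simp
    have facets: "?F facet_of P" "?G facet_of P"
      unfolding PQ using facet_Int_ball(1)[OF Q dim(1)] FG by auto
    have ang: "dihedral_angle_at P ?F ?G x = \<alpha>"
      using assms(5) facets d xFG unfolding all_dihedral_angles_def by blast
    obtain y where y: "y \<in> interior Q" using intQ by blast
    then have "y \<in> P" using intQ_ball interior_subset PQ by blast
    have "a \<bullet> a' - b * b' = - cos \<alpha>"
    proof (rule dihedral_angle_imp_inner[OF _ _ _ _ _ _ _ _ \<open>y \<in> P\<close> _ _ xFG x(2) ang])
      show "?F = P \<inter> {y. a \<bullet> y = b}" "P \<subseteq> {y. a \<bullet> y \<le> b}" "a \<bullet> a - b * b = 1"
        using Fa PQ by (auto simp: facet_covector_def)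
      show "?G = P \<inter> {y. a' \<bullet> y = b'}" "P \<subseteq> {y. a' \<bullet> y \<le> b'}" "a' \<bullet> a' - b' * b' = 1"
        using Ga PQ by (auto simp: facet_covector_def)
      show "aff_dim ?F = 3" "aff_dim ?G = 3"
        using facet_Int_ball(3)[OF Q dim(1)] FG by auto
      show "a \<bullet> y < b" "a' \<bullet> y < b'"
        using facet_covector_strict_interior[OF conv intQ _ _ y] FG Fa Ga by blast+
    qed
    then show ?thesis by (simp add: c_def)
  qed
  have vertex: "card {F. F facet_of Q \<and> v \<in> F} = 4" "norm v < 1 \<Longrightarrow> 3 * c < 1" "norm v = 1 \<Longrightarrow> 3 * c = 1"
    if v: "v extreme_point_of Q" for v
  proof -
    note equiangular = equiangular_polytope_vertex[OF Q dim(1) c _ v]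
    show "card {F. F facet_of Q \<and> v \<in> F} = 4"
      using equiangular(1) ridge by simp
    show "3 * c < 1" if "norm v < 1"
      using equiangular(2) ridge that by simp
    show "3 * c = 1" if "norm v = 1"
      using equiangular(3) ridge that by simp
  qed
  have simple: "simple_hyp_polytope P"
    unfolding simple_hyp_polytope_def
  proof
    fix v assume "v \<in> vertices P"
    then have v: "v extreme_point_of Q" using verts by simp
    have "{F. F facet_of P \<and> v \<in> closure F} = (\<lambda>F. F \<inter> hyp_space) ` {F. F facet_of Q \<and> v \<in> F}"
    proof (intro set_eqI iffI)
      fix F assume F: "F \<in> {F. F facet_of P \<and> v \<in> closure F}"
      then obtain F' where F': "F' facet_of Q" "F = F' \<inter> hyp_space"
        using facet_of_Int_ball_imp[OF Q dim(1)] PQ by blast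
      then show "F \<in> (\<lambda>F. F \<inter> hyp_space) ` {F. F facet_of Q \<and> v \<in> F}"
        using F facet_Int_ball(2)[OF Q dim(1) F'(1)] by auto
    next
      fix F assume "F \<in> (\<lambda>F. F \<inter> hyp_space) ` {F. F facet_of Q \<and> v \<in> F}"
      then show "F \<in> {F. F facet_of P \<and> v \<in> closure F}"
        using facet_Int_ball(1,2)[OF Q dim(1)] PQ by auto
    qed
    moreover have "inj_on (\<lambda>F. F \<inter> hyp_space) {F. F facet_of Q \<and> v \<in> F}"
      by (rule inj_on_inverseI[where g = closure]) (use facet_Int_ball(2)[OF Q dim(1)] in auto)
    ultimately show "card {F. F facet_of P \<and> v \<in> closure F} = 4"
      using vertex(1)[OF v] by (simp add: card_image)
  qed
  have finite_vertex: "\<alpha> > arccos (1 / 3)" if "v \<in> vertices P" "norm v < 1" for v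
  proof -
    have "v extreme_point_of Q" using that verts by simp
    then have "cos \<alpha> < 1 / 3"
      using vertex(2)[of v] that(2) by (simp add: c_def)
    then show ?thesis
      using arccos_less_mono[of "1/3" "cos \<alpha>"] c assms(3,4) by (simp add: c_def arccos_cos)
  qed
  have ideal_vertex: "\<alpha> = arccos (1 / 3)" if "v \<in> vertices P" "norm v = 1" for v
  proof -
    have "v extreme_point_of Q" using that verts by simp
    then have "cos \<alpha> = 1 / 3"
      using vertex(3)[of v] that(2) by (simp add: c_def)
    then have "arccos (1 / 3) = arccos (cos \<alpha>)" by (simp only:)
    also have "\<dots> = \<alpha>" using assms(3,4) by (intro arccos_cos) auto
    finally show ?thesis by simp
  qed
  have norms: "norm v < 1 \<or> norm v = 1" if "v \<in> vertices P" for v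
    using that QB verts by (force simp: extreme_point_of_def)
  have "Q \<noteq> {}"
    using intQ interior_subset by auto
  then obtain v where v: "v \<in> vertices P"
    using extreme_point_exists_convex[OF comp conv] verts by (metis mem_Collect_eq)
  have ge: "\<alpha> \<ge> arccos (1 / 3)"
    using norms[OF v] finite_vertex[OF v] ideal_vertex[OF v] by auto
  have ideal: "vertices P \<subseteq> sphere_at_infinity" if "\<alpha> = arccos (1 / 3)"
    using finite_vertex norms that by force
  have compact_case: "vertices P \<subseteq> hyp_space \<and> compact P" if "\<alpha> > arccos (1 / 3)"
  proof -
    have sub: "vertices P \<subseteq> hyp_space"
      using ideal_vertex norms that by force
    have "Q = convex hull (vertices P)"
      using Krein_Milman_Minkowski[OF comp conv] verts by simp
    also have "\<dots> \<subseteq> hyp_space"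
      using sub by (intro hull_minimal) auto
    finally have "P = Q" using PQ by blast
    then show ?thesis using sub comp by simp
  qed
  show ?thesis
    using simple ge ideal compact_case by blast
qed

end
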